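(* For all $k,\ell,D\in\mathbb{N}$ and $\epsilon,\delta>0$, there exists $C>0$ such that the following holds. There exists a $C\log n$-space streaming algorithm that, for every $D$-bounded graph $G=([n],E)$ with a proper $k$-coloring $\chi:[n]\to[k]$, given black-box access to $\chi$ and a single, randomly-ordered pass over $G$'s edges, outputs a distribution $\mathcal{D}$ on $\mathcal{T}_{k,\ell,D}$ satisfying $d_{TV}(\mathcal{D},\mathrm{EdgeDist}_{G,\chi,\ell})\le\epsilon$ except with probability $\delta$.
   Context: A graph is a directed multigraph $G=(V,E)$ with $V$ finite and $E$ a finite multiset of ordered pairs $(u,v)$, $u\ne v$. The degree of a vertex counts incident edges with multiplicity in both directions; $G$ is $D$-bounded if all degrees are at most $D$. A path of length $L$ between $u,v$ is a sequence $u=w_0,\dots,w_L=v$ with $(w_{i-1},w_i)\in E$ or $(w_i,w_{i-1})\in E$ for each $i$ (directions ignored). $B_G(\ell,v)$ is the set of vertices joined to $v$ by a path of length at most $\ell$, and for an edge $e=(u,v)$, $B_G(\ell,e)=B_G(\ell,u)\cup B_G(\ell,v)$. For $U\subseteq V$, $G[U]=(U,E[U])$ where $E[U]$ is the multiset of edges of $E$ with both endpoints in $U$. A proper $k$-coloring is $\chi:V\to[k]$ with $\chi(u)\ne\chi(v)$ for every edge $(u,v)$. A doubly rooted $k$-colored graph is a triple $(H,\psi,e)$ with $H$ a graph, $\psi$ a proper $k$-coloring of $H$ and $e$ an edge of $H$. Two such triples $(H,\psi,e)$, $(H',\psi',e')$ with $H=(W,F)$, $H'=(W',F')$ are isomorphic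 if there is a bijection $\phi:W\to W'$ such that the multiplicity of $(u,v)$ in $F$ equals that of $(\phi(u),\phi(v))$ in $F'$ for all $u\ne v$, $\psi(w)=\psi'(\phi(w))$ for all $w$ (colors are not permuted), and $\phi(e)=e'$. The type of a triple is its isomorphism class. $\mathcal{T}_{k,\ell,D}$ is the finite set of types of $D$-bounded doubly rooted $k$-colored graphs in which every vertex is within distance $\ell$ of at least one endpoint of the root edge. For a properly $k$-colored graph $(G,\chi)$ and $e\in E$, the radius-$\ell$ neighborhood type of $e$ is the type of $(G[N],\chi|_N,e)$ with $N=B_G(\ell,e)$. For $D$-bounded $(G,\chi)$ with $E\neq\emptyset$, $\mathrm{EdgeDist}_{G,\chi,\ell}$ is the distribution on $\mathcal{T}_{k,\ell,D}$ of the radius-$\ell$ neighborhood type of an edge drawn uniformly from the multiset $E$. $d_{TV}(\mathcal{X},\mathcal{Y})=\frac12\sum_s|\mathcal{X}(s)-\mathcal{Y}(s)|$. In a randomly-ordered pass the edges of $E$ (as a multiset) arrive in a uniformly random order; the failure probability is over this order and the algorithm's randomness. *)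

theory Defs
  imports
    "HOL-Probability.Probability"
    "HOL-Combinatorics.Multiset_Permutations"
    "HOL-Library.FuncSet"
begin

type_synonym edge = "nat \<times> nat"
type_synonym graph = "nat set \<times> edge multiset"

definition is_graph :: "graph \<Rightarrow> bool" where
  "is_graph = (\<lambda>(V, E). finite V \<and> (\<forall>(u, v) \<in># E. u \<in> V \<and> v \<in> V \<and> u \<noteq> v))"

definition vertex_degree :: "graph \<Rightarrow> nat \<Rightarrow> nat" where
  "vertex_degree = (\<lambda>(V, E) v. size {# e \<in># E. fst e = v \<or> snd e = v #})"

definition degree_bounded :: "nat \<Rightarrow> graph \<Rightarrow> bool" where
  "degree_bounded D G \<longleftrightarrow> (\<forall>v \<in> fst G. vertex_degree G v \<le> D)"

definition path_between :: "graph \<Rightarrow> nat \<Rightarrow> nat \<Rightarrow> nat \<Rightarrow> bool" where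
  "path_between = (\<lambda>(V, E) L u v. \<exists>w :: nat \<Rightarrow> nat. w 0 = u \<and> w L = v \<and>
     (\<forall>i \<in> {1..L}. (w (i - 1), w i) \<in># E \<or> (w i, w (i - 1)) \<in># E))"

definition vertex_ball :: "graph \<Rightarrow> nat \<Rightarrow> nat \<Rightarrow> nat set" where
  "vertex_ball G l v = {x \<in> fst G. \<exists>L \<le> l. path_between G L x v}"

definition edge_ball :: "graph \<Rightarrow> nat \<Rightarrow> edge \<Rightarrow> nat set" where
  "edge_ball G l = (\<lambda>(u, v). vertex_ball G l u \<union> vertex_ball G l v)"

definition induced_subgraph :: "graph \<Rightarrow> nat set \<Rightarrow> graph" where
  "induced_subgraph = (\<lambda>(V, E) U. (U, {# e \<in># E. fst e \<in> U \<and> snd e \<in> U #}))"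

definition proper_coloring :: "nat \<Rightarrow> graph \<Rightarrow> (nat \<Rightarrow> nat) \<Rightarrow> bool" where
  "proper_coloring k = (\<lambda>(V, E) \<kappa>. \<kappa> \<in> V \<rightarrow>\<^sub>E {1..k} \<and> (\<forall>(u, v) \<in># E. \<kappa> u \<noteq> \<kappa> v))"


type_synonym rooted = "graph \<times> (nat \<Rightarrow> nat) \<times> edge"

definition doubly_rooted :: "nat \<Rightarrow> rooted set" where
  "doubly_rooted k = {(H, \<psi>, e). is_graph H \<and> proper_coloring k H \<psi> \<and> e \<in># snd H}"

definition rooted_iso :: "rooted \<Rightarrow> rooted \<Rightarrow> bool" where
  "rooted_iso = (\<lambda>((W, F), \<psi>, e) ((W', F'), \<psi>', e').
     \<exists>\<phi>. bij_betw \<phi> W W' \<and>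
       (\<forall>u \<in> W. \<forall>v \<in> W. u \<noteq> v \<longrightarrow> count F (u, v) = count F' (\<phi> u, \<phi> v)) \<and>
       (\<forall>w \<in> W. \<psi> w = \<psi>' (\<phi> w)) \<and>
       map_prod \<phi> \<phi> e = e')"

text \<open>Isomorphism classes are formed among graphs whose vertices are natural numbers; every finite
  graph is isomorphic to one of these.\<close>

type_synonym rooted_type = "rooted set"

definition type_of :: "nat \<Rightarrow> rooted \<Rightarrow> rooted_type" where
  "type_of k R = {R' \<in> doubly_rooted k. rooted_iso R R'}"

definition types :: "nat \<Rightarrow> nat \<Rightarrow> nat \<Rightarrow> rooted_type set" where
  "types k l D = {type_of k (H, \<psi>, e) | H \<psi> e.
     (H, \<psi>, e) \<in> doubly_rooted k \<and> degree_bounded D H \<and> (\<forall>w \<in> fst H. w \<in> edge_ball H l e)}"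

definition nbhd_type :: "nat \<Rightarrow> nat \<Rightarrow> graph \<Rightarrow> (nat \<Rightarrow> nat) \<Rightarrow> edge \<Rightarrow> rooted_type" where
  "nbhd_type k l G \<kappa> e =
     (let N = edge_ball G l e in type_of k (induced_subgraph G N, restrict \<kappa> N, e))"

text \<open>Only meaningful for graphs with at least one edge.\<close>

definition edge_dist :: "nat \<Rightarrow> nat \<Rightarrow> graph \<Rightarrow> (nat \<Rightarrow> nat) \<Rightarrow> rooted_type pmf" where
  "edge_dist k l G \<kappa> = map_pmf (nbhd_type k l G \<kappa>) (pmf_of_multiset (snd G))"

definition d_TV :: "'a pmf \<Rightarrow> 'a pmf \<Rightarrow> real" where
  "d_TV X Y = 1 / 2 * (\<Sum>\<^sub>\<infinity>s. \<bar>pmf X s - pmf Y s\<bar>)"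


text \<open>A streaming algorithm is a machine whose entire configuration, apart from the unread part of
  the stream, is a bit string. The current memory content determines the next instruction: read the
  next edge (\<^term>\<open>None\<close> signals the end of the stream), ask the oracle for the color of one
  vertex, toss a fair coin, or stop with an output. Hence also the workspace used between two edges,
  the answers of the oracle and all random bits that are remembered count towards the space.\<close>

type_synonym memory = "bool list"

datatype 'o instruction =
    Read "edge option \<Rightarrow> memory"
  | Query nat "nat \<Rightarrow> memory"
  | Flip memory memory
  | Output 'o

record 'o streaming_alg =
  start :: memory
  instr :: "memory \<Rightarrow> 'o instruction"

text \<open>\<open>is_streaming_alg n s Out A\<close>: on vertex set \<open>{1..n}\<close>, the algorithm \<open>A\<close> runs in a memory of
  exactly \<open>s\<close> bits and only produces outputs in \<open>Out\<close>.\<close>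

definition is_streaming_alg :: "nat \<Rightarrow> nat \<Rightarrow> 'o set \<Rightarrow> 'o streaming_alg \<Rightarrow> bool" where
  "is_streaming_alg n s Out A \<longleftrightarrow> length (start A) = s \<and>
     (\<forall>m. length m = s \<longrightarrow>
       (case instr A m of
          Read f \<Rightarrow> (\<forall>x. length (f x) = s)
        | Query v f \<Rightarrow> v \<in> {1..n} \<and> (\<forall>c. length (f c) = s)
        | Flip m0 m1 \<Rightarrow> length m0 = s \<and> length m1 = s
        | Output y \<Rightarrow> y \<in> Out))"

text \<open>The result of at most \<open>t\<close> steps with oracle \<open>\<kappa>\<close>, from memory \<open>m\<close> and remaining stream \<open>es\<close>;
  \<^term>\<open>None\<close> means that the machine has not stopped yet. The stream is consumed by reading, so there
  is only one pass.\<close>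

fun run :: "'o streaming_alg \<Rightarrow> (nat \<Rightarrow> nat) \<Rightarrow> nat \<Rightarrow> memory \<Rightarrow> edge list \<Rightarrow> 'o option pmf" where
  "run A \<kappa> 0 m es = return_pmf None"
| "run A \<kappa> (Suc t) m es =
     (case instr A m of
        Read f \<Rightarrow> (case es of [] \<Rightarrow> run A \<kappa> t (f None) [] | e # es' \<Rightarrow> run A \<kappa> t (f (Some e)) es')
      | Query v f \<Rightarrow> run A \<kappa> t (f (\<kappa> v)) es
      | Flip m0 m1 \<Rightarrow> bind_pmf (bernoulli_pmf (1 / 2)) (\<lambda>b. run A \<kappa> t (if b then m1 else m0) es)
      | Output y \<Rightarrow> return_pmf (Some y))"

text \<open>Every arrangement of a multiset comes from the same number of orders of its labelled elements,
  so the uniform distribution on arrangements is that of a uniformly random arrival order.\<close>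

definition random_order_run ::
    "'o streaming_alg \<Rightarrow> (nat \<Rightarrow> nat) \<Rightarrow> nat \<Rightarrow> edge multiset \<Rightarrow> 'o option pmf" where
  "random_order_run A \<kappa> t E =
     bind_pmf (pmf_of_set (permutations_of_multiset E)) (run A \<kappa> t (start A))"

end

theory Submission
  imports Defs
begin

text \<open>The first \<open>r\<close> edges of the stream serve as random roots. From each root a subgraph is grown by
  keeping every later edge that is visibly within distance \<open>l\<close> of the root. Edges arriving too early
  are missed, so the observed type is only a random subtype of the true neighborhood type. Its
  distribution depends on the true type alone; it never has more edges than the true type, and it
  equals the true type with positive probability. So the kernel from true to observed types is triangular with respect to the number of
  edges, with positive diagonal, hence robustly invertible. The output is therefore any distribution
  on types whose image under the kernel fits the observed frequencies.

  Roots whose neighborhoods are pairwise disjoint are observed independently of each other, because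
  the restrictions of a random order to disjoint sets of edges are independent; and a repetition-free
  tuple of roots is at least as likely when drawn without replacement as when drawn with
  replacement. So the success probability is at least that of \<open>r\<close> independent observations, which
  concentrate by Hoeffding's inequality, minus the probability that two independent roots are close,
  which is \<open>O(r\<^sup>2 / m)\<close> for \<open>m\<close> edges. If \<open>m\<close> is below a constant, the whole graph is stored.\<close>

section \<open>Random orders and frequencies\<close>

text \<open>The obstacle is that a missed edge leaves no trace: an incomplete observation looks
  exactly like a complete one of a smaller type, so incomplete samples can be neither detected nor
  discarded. Hence the bias is inverted rather than avoided. The constant of the inversion depends
  only on \<open>k\<close>, \<open>l\<close> and \<open>D\<close>; it fixes the required accuracy,
  then the number \<open>r\<close> of roots and then the threshold \<open>M\<close>, all
  independently of \<open>n\<close>. The inverse is never computed: once the frequencies are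
  accurate, the true edge distribution is itself a fit, so a fit exists, and any two fits have close
  images under the kernel and are therefore close. The kernel is a function of the type because an
  exploration depends only on the relative order of the edges of the true neighborhood, which is
  uniform, and because exploring commutes with renaming vertices. Constantly many stored edges leave
  at most \<open>n ^ e\<close> states for a constant \<open>e\<close>, which can be numbered with
  \<open>O(log n)\<close> bits.\<close>

lemma pmf_eq_pmf_of_setI:
  assumes "finite S" and "set_pmf p \<subseteq> S" and c: "\<And>x. x \<in> S \<Longrightarrow> pmf p x = c"
  shows "p = pmf_of_set S"
proof (rule pmf_eqI)
  fix x
  have ne: "S \<noteq> {}" using assms(2) set_pmf_not_empty[of p] by auto
  have "(\<Sum>x\<in>S. pmf p x) = 1" using assms by (intro sum_pmf_eq_1)
  then have "real (card S) * c = 1" by (simp add: c)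
  then have c': "c = 1 / card S" by (metis nonzero_mult_div_cancel_left mult_eq_0_iff zero_neq_one)
  show "pmf p x = pmf (pmf_of_set S) x"
  proof (cases "x \<in> S")
    case True then show ?thesis using assms ne c' by simp
  next
    case False then show ?thesis using assms ne by (auto simp: pmf_eq_0_set_pmf)
  qed
qed

text \<open>The orders of \<open>A\<close> that split into given parts \<open>xs\<close> and
  \<open>ys\<close> are their shuffles. The number of these is a binomial coefficient in the two
  lengths, hence the same for all pairs of parts.\<close>

lemma partition_random_permutation_of_multiset:
  "map_pmf (partition P) (pmf_of_set (permutations_of_multiset A)) =
     pair_pmf (pmf_of_set (permutations_of_multiset {#x \<in># A. P x#}))
              (pmf_of_set (permutations_of_multiset {#x \<in># A. \<not> P x#}))" (is "?lhs = ?rhs")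
proof -
  let ?S1 = "permutations_of_multiset {#x \<in># A. P x#}"
  let ?S2 = "permutations_of_multiset {#x \<in># A. \<not> P x#}"
  have "?lhs = pmf_of_set (?S1 \<times> ?S2)"
  proof (rule pmf_eq_pmf_of_setI)
    show "set_pmf ?lhs \<subseteq> ?S1 \<times> ?S2"
      by (auto simp: o_def permutations_of_multisetI dest!: permutations_of_multisetD)
    fix z assume z: "z \<in> ?S1 \<times> ?S2"
    obtain xs ys where z_eq: "z = (xs, ys)" by force
    have mx: "mset xs = {#x \<in># A. P x#}" and my: "mset ys = {#x \<in># A. \<not> P x#}"
      using z by (auto simp: z_eq permutations_of_multiset_def)
    have sx: "set xs \<subseteq> {x. P x}" and sy: "set ys \<subseteq> {x. \<not> P x}"
      using arg_cong[OF mx, of set_mset] arg_cong[OF my, of set_mset] by auto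
    have len: "length xs = size {#x \<in># A. P x#}" "length ys = size {#x \<in># A. \<not> P x#}"
      by (simp_all flip: mx my)
    have "pmf ?lhs z =
        card (permutations_of_multiset A \<inter> partition P -` {z}) / card (permutations_of_multiset A)"
      by (simp add: pmf_map measure_pmf_of_set)
    also have "partition P -` {z} = shuffles xs ys"
      unfolding z_eq using sx sy by (intro inv_image_partition) auto
    also have "permutations_of_multiset A \<inter> shuffles xs ys = shuffles xs ys"
      using mset_shuffles[of _ xs ys] multiset_partition[of A P]
      by (auto simp: permutations_of_multiset_def mx my)
    also have "card (shuffles xs ys) = length xs + length ys choose length xs"
      using sx sy by (intro card_disjoint_shuffles) auto
    finally show "pmf ?lhs z = real (size {#x \<in># A. P x#} + size {#x \<in># A. \<not> P x#}
        choose size {#x \<in># A. P x#}) / card (permutations_of_multiset A)"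
      unfolding len .
  qed auto
  moreover have "?rhs = pmf_of_set (?S1 \<times> ?S2)"
    by (rule pmf_eq_pmf_of_setI[where c = "1 / (card ?S1 * card ?S2)"]) (auto simp: pmf_pair)
  ultimately show ?thesis by simp
qed

text \<open>Independent draws with different laws: once the roots are fixed, the observations are
  independent but not identically distributed.\<close>

fun sequence_pmf :: "'a pmf list \<Rightarrow> 'a list pmf" where
  "sequence_pmf [] = return_pmf []"
| "sequence_pmf (p # ps) = bind_pmf p (\<lambda>x. map_pmf ((#) x) (sequence_pmf ps))"

text \<open>All draws from \<open>p\<close> can be made before all draws from \<open>f\<close>.
  Averaging over the roots thus turns the differing laws back into identical ones.\<close>

lemma replicate_bind_pmf_eq_sequence:
  "replicate_pmf r (bind_pmf p f) = bind_pmf (replicate_pmf r p) (\<lambda>as. sequence_pmf (map f as))"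
proof (induction r)
  case 0
  then show ?case by (simp add: bind_return_pmf)
next
  case (Suc r)
  have "replicate_pmf (Suc r) (bind_pmf p f) =
     bind_pmf p (\<lambda>a. bind_pmf (f a) (\<lambda>x. bind_pmf (replicate_pmf r p)
        (\<lambda>as. map_pmf ((#) x) (sequence_pmf (map f as)))))"
    by (simp add: Suc bind_assoc_pmf map_pmf_def)
  also have "\<dots> = bind_pmf p (\<lambda>a. bind_pmf (replicate_pmf r p) (\<lambda>as. bind_pmf (f a)
        (\<lambda>x. map_pmf ((#) x) (sequence_pmf (map f as)))))"
    by (subst bind_commute_pmf[of "f _"]) simp
  finally show ?case by (simp add: bind_assoc_pmf bind_return_pmf)
qed

text \<open>Induction on \<open>as\<close>: partitioning by \<open>cl a\<close> yields two
  independent uniform orders. The first determines the observation of \<open>a\<close>; the other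
  classes are disjoint from \<open>cl a\<close> and see only the second.\<close>

lemma random_permutation_filters_independent:
  fixes cl :: "'a \<Rightarrow> 'b set" and obs :: "'a \<Rightarrow> 'b list \<Rightarrow> 'c"
  assumes "sorted_wrt (\<lambda>a b. cl a \<inter> cl b = {}) as"
  shows "map_pmf (\<lambda>\<rho>. map (\<lambda>a. obs a (filter (\<lambda>x. x \<in> cl a) \<rho>)) as)
           (pmf_of_set (permutations_of_multiset A)) =
         sequence_pmf (map (\<lambda>a. map_pmf (obs a)
           (pmf_of_set (permutations_of_multiset {#x \<in># A. x \<in> cl a#}))) as)"
  using assms
proof (induction as arbitrary: A)
  case Nil
  then show ?case by simp
next
  case (Cons a as)
  let ?P = "\<lambda>x. x \<in> cl a"
  let ?p1 = "pmf_of_set (permutations_of_multiset {#x \<in># A. ?P x#})"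
  let ?p2 = "pmf_of_set (permutations_of_multiset {#x \<in># A. \<not> ?P x#})"
  let ?g = "\<lambda>\<rho>. map (\<lambda>a. obs a (filter (\<lambda>x. x \<in> cl a) \<rho>)) as"
  have disj: "cl a \<inter> cl b = {}" if "b \<in> set as" for b using Cons.prems that by auto
  have f1: "filter (\<lambda>x. x \<in> cl b) (filter (\<lambda>x. \<not> ?P x) \<rho>) = filter (\<lambda>x. x \<in> cl b) \<rho>"
    if "b \<in> set as" for b \<rho>
    using disj[OF that] by (induction \<rho>) auto
  have f2: "{#x \<in># {#x \<in># A. \<not> ?P x#}. x \<in> cl b#} = {#x \<in># A. x \<in> cl b#}"
    if "b \<in> set as" for b
    using disj[OF that] by (auto simp: filter_filter_mset intro!: filter_mset_cong)
  have "map_pmf (\<lambda>\<rho>. map (\<lambda>a. obs a (filter (\<lambda>x. x \<in> cl a) \<rho>)) (a # as))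
           (pmf_of_set (permutations_of_multiset A)) =
        map_pmf (\<lambda>(xs, ys). obs a xs # ?g ys)
          (map_pmf (partition ?P) (pmf_of_set (permutations_of_multiset A)))"
    by (auto simp: map_pmf_comp o_def f1 simp del: filter_filter intro!: map_pmf_cong)
  also have "\<dots> = map_pmf (\<lambda>(xs, ys). obs a xs # ?g ys) (pair_pmf ?p1 ?p2)"
    by (simp only: partition_random_permutation_of_multiset)
  also have "\<dots> = bind_pmf (map_pmf (obs a) ?p1) (\<lambda>x. map_pmf ((#) x) (map_pmf ?g ?p2))"
    by (simp add: pair_pmf_def map_bind_pmf bind_map_pmf map_pmf_comp map_pmf_def[symmetric])
  also have "map_pmf ?g ?p2 = sequence_pmf (map (\<lambda>a. map_pmf (obs a)
           (pmf_of_set (permutations_of_multiset {#x \<in># {#x \<in># A. \<not> ?P x#}. x \<in> cl a#}))) as)"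
    using Cons by simp
  also have "\<dots> = sequence_pmf (map (\<lambda>a. map_pmf (obs a)
           (pmf_of_set (permutations_of_multiset {#x \<in># A. x \<in> cl a#}))) as)"
    by (intro arg_cong[where f = sequence_pmf] map_cong) (simp_all add: f2)
  finally show ?case by simp
qed

section \<open>Random prefixes compared with independent draws\<close>

lemma random_permutation_of_multiset_Cons:
  assumes "a \<in># E"
  shows "measure_pmf.prob (pmf_of_set (permutations_of_multiset E)) ((#) a ` S) =
    count E a / size E *
      measure_pmf.prob (pmf_of_set (permutations_of_multiset (E - {#a#}))) S"
proof -
  let ?c = "\<lambda>A. real (card (permutations_of_multiset A))"
  have "permutations_of_multiset E \<inter> (#) a ` S = (#) a ` (permutations_of_multiset (E - {#a#}) \<inter> S)"
    using assms by (auto simp: permutations_of_multiset_Cons_iff)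
  then have "card (permutations_of_multiset E \<inter> (#) a ` S) =
      card (permutations_of_multiset (E - {#a#}) \<inter> S)"
    by (simp add: card_image)
  moreover have "?c (E - {#a#}) = ?c E * count E a / size E"
    using assms by (simp add: real_card_permutations_of_multiset_remove)
  moreover have "size E > 0" "count E a > 0" "?c E > 0"
    using assms by (auto simp: card_gt_0_iff nonempty_has_size[symmetric])
  ultimately show ?thesis by (simp add: measure_pmf_of_set field_simps)
qed

lemma pmf_replicate_pmf:
  "pmf (replicate_pmf (length xs) p) xs = prod_list (map (pmf p) xs)"
proof (induction xs)
  case (Cons x xs)
  have "replicate_pmf (length (x # xs)) p =
      map_pmf (\<lambda>(x, xs). x # xs) (pair_pmf p (replicate_pmf (length xs) p))"
    by (simp add: pair_pmf_def map_bind_pmf)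
  moreover have "pmf (map_pmf (\<lambda>(x, xs). x # xs) (pair_pmf p (replicate_pmf (length xs) p))) (x # xs)
      = pmf (pair_pmf p (replicate_pmf (length xs) p)) (x, xs)"
    using pmf_map_inj'[of "\<lambda>(x, xs). x # xs" _ "(x, xs)"] by (auto simp: inj_def)
  ultimately show ?case using Cons by (simp add: pmf_pair)
qed simp

text \<open>At each position the remaining multiset is smaller, which only raises the chance of the
  next prescribed element, and the multiplicity of that element is still the original one because
  the tuple is repetition-free. The denominator \<open>m\<close> is decoupled from
  \<open>size E\<close> so that it stays fixed in the induction.\<close>

lemma random_permutation_prefix_ge:
  assumes "distinct as" and "set as \<subseteq> set_mset E" and "size E \<le> m"
  shows "measure_pmf.prob (pmf_of_set (permutations_of_multiset E)) ((@) as ` S) \<ge>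
    prod_list (map (\<lambda>a. count E a / m) as) *
      measure_pmf.prob (pmf_of_set (permutations_of_multiset (E - mset as))) S"
  using assms
proof (induction as arbitrary: E)
  case Nil
  then show ?case by simp
next
  case (Cons a as)
  let ?pr = "\<lambda>A. measure_pmf.prob (pmf_of_set (permutations_of_multiset A))"
  have a: "a \<in># E" "size E > 0" using Cons.prems by (auto simp: nonempty_has_size[symmetric])
  have "count (E - {#a#}) b = count E b" if "b \<in> set as" for b
    using that Cons.prems by auto
  then have cnt: "map (\<lambda>b. count (E - {#a#}) b / m) as = map (\<lambda>b. count E b / m) as"
    by (auto intro!: map_cong)
  have "set as \<subseteq> set_mset (E - {#a#})"
    using Cons.prems by (auto simp: in_diff_count)
  moreover have "size (E - {#a#}) \<le> m" using Cons.prems by (meson diff_subset_eq_self le_trans size_mset_mono)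
  ultimately have IH: "prod_list (map (\<lambda>b. count E b / m) as) * ?pr (E - {#a#} - mset as) S \<le>
      ?pr (E - {#a#}) ((@) as ` S)"
    using Cons.IH[of "E - {#a#}", unfolded cnt] Cons.prems by simp
  have "prod_list (map (\<lambda>a. count E a / m) (a # as)) * ?pr (E - mset (a # as)) S =
      count E a / m * (prod_list (map (\<lambda>b. count E b / m) as) * ?pr (E - {#a#} - mset as) S)"
    by (simp add: diff_diff_add_mset)
  also have "\<dots> \<le> count E a / m * ?pr (E - {#a#}) ((@) as ` S)"
    using IH by (intro mult_left_mono) auto
  also have "\<dots> \<le> count E a / size E * ?pr (E - {#a#}) ((@) as ` S)"
    using a Cons.prems by (intro mult_right_mono divide_left_mono) auto
  also have "\<dots> = ?pr E ((#) a ` ((@) as ` S))"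
    using a by (simp add: random_permutation_of_multiset_Cons)
  also have "(#) a ` ((@) as ` S) = (@) (a # as) ` S" by (auto simp: image_image)
  finally show ?case .
qed

lemma measure_bind_pmf:
  "measure_pmf.prob (bind_pmf p f) S = measure_pmf.expectation p (\<lambda>x. measure_pmf.prob (f x) S)"
proof -
  have "ennreal (measure_pmf.prob (bind_pmf p f) S) =
      (\<integral>\<^sup>+x. ennreal (measure_pmf.prob (f x) S) \<partial>p)"
    by (simp flip: measure_pmf.emeasure_eq_measure)
  also have "\<dots> = ennreal (measure_pmf.expectation p (\<lambda>x. measure_pmf.prob (f x) S))"
    by (intro nn_integral_eq_integral measure_pmf.integrable_const_bound[where B = 1]) auto
  finally show ?thesis by (simp add: integral_nonneg)
qed

text \<open>Sum over root tuples. For a good tuple, the event that the stream starts with it and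
  yields an outcome in \<open>S\<close> has at least the mass of the same event in the independent
  experiment. A bad tuple is written off with its full mass, which gives the subtracted
  term.\<close>

lemma random_order_ge_independent:
  fixes E :: "'a multiset" and cl :: "'a \<Rightarrow> 'a set" and obs :: "'a \<Rightarrow> 'a list \<Rightarrow> 'c"
  assumes E: "E \<noteq> {#}" and self: "\<And>a. a \<in># E \<Longrightarrow> a \<in> cl a"
  defines "good \<equiv> (\<lambda>as. sorted_wrt (\<lambda>a b. cl a \<inter> cl b = {}) as)"
  defines "kern \<equiv> (\<lambda>a. map_pmf (obs a)
     (pmf_of_set (permutations_of_multiset ({#x \<in># E. x \<in> cl a#} - {#a#}))))"
  shows "measure_pmf.prob (pmf_of_set (permutations_of_multiset E))
      {\<pi>. length \<pi> \<ge> r \<and> good (take r \<pi>) \<and>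
         map (\<lambda>a. obs a (filter (\<lambda>x. x \<in> cl a) (drop r \<pi>))) (take r \<pi>) \<in> S} \<ge>
    measure_pmf.prob (replicate_pmf r (bind_pmf (pmf_of_multiset E) kern)) S -
    measure_pmf.prob (replicate_pmf r (pmf_of_multiset E)) {as. \<not> good as}"
proof -
  let ?J = "replicate_pmf r (pmf_of_multiset E)"
  let ?pr = "\<lambda>A. measure_pmf.prob (pmf_of_set (permutations_of_multiset A))"
  let ?out = "\<lambda>as \<rho>. map (\<lambda>a. obs a (filter (\<lambda>x. x \<in> cl a) \<rho>)) as"
  let ?ps = "\<lambda>as. measure_pmf.prob (sequence_pmf (map kern as)) S"
  let ?A = "\<lambda>as. (@) as ` {\<rho>. ?out as \<rho> \<in> S}"
  have setJ: "set_pmf ?J = {as. set as \<subseteq> set_mset E \<and> length as = r}"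
    using E by (auto simp: set_replicate_pmf)
  have finJ: "finite (set_pmf ?J)"
    unfolding setJ by (rule finite_lists_length_eq) simp
  define Good where "Good = {as \<in> set_pmf ?J. good as}"
  have finG: "finite Good" using finJ by (simp add: Good_def)
  have key: "pmf ?J as * ?ps as \<le> ?pr E (?A as)" if "as \<in> Good" for as
  proof -
    have sub: "set as \<subseteq> set_mset E" and len: "length as = r" and g: "good as"
      using that by (auto simp: Good_def setJ)
    have pw: "cl (as ! i) \<inter> cl (as ! j) = {}" if "i < j" "j < length as" for i j
      using g that by (auto simp: good_def sorted_wrt_iff_nth_less)
    have pw': "cl (as ! i) \<inter> cl (as ! j) = {}" if "i \<noteq> j" "i < length as" "j < length as" for i j
      using pw[of i j] pw[of j i] that by (cases i j rule: linorder_cases) auto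
    have notin: "as ! i \<notin> cl (as ! j)" if "i \<noteq> j" "i < length as" "j < length as" for i j
      using pw'[OF that] self[of "as ! i"] sub nth_mem[OF that(2)] by auto
    \<comment> \<open>By \<open>self\<close> a repeated root would lie in two classes that are
      supposed to be disjoint.\<close>
    have dist: "distinct as"
      unfolding distinct_conv_nth using notin self sub nth_mem by (metis subsetD)
    \<comment> \<open>The other roots lie outside \<open>cl a\<close>, so taking all roots out of
      \<open>E\<close> removes just one copy of \<open>a\<close> from the class, as in
      \<open>kern\<close>.\<close>
    have flt: "{#x \<in># E - mset as. x \<in> cl a#} = {#x \<in># E. x \<in> cl a#} - {#a#}"
      if "a \<in> set as" for a
    proof (rule multiset_eqI)
      fix x
      have "x = a" if "x \<in> set as" "x \<in> cl a"
        using that \<open>a \<in> set as\<close> notin by (metis in_set_conv_nth)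
      then show "count {#x \<in># E - mset as. x \<in> cl a#} x = count ({#x \<in># E. x \<in> cl a#} - {#a#}) x"
        using dist \<open>a \<in> set as\<close> self[of a] sub
        by (auto simp: distinct_count_atmost_1 dest: count_list_0_iff[THEN iffD2] simp flip: count_mset)
    qed
    have "pmf ?J as = prod_list (map (\<lambda>a. count E a / size E) as)"
      using pmf_replicate_pmf[of as "pmf_of_multiset E"] E by (simp add: len cong: map_cong)
    moreover have "?ps as = ?pr (E - mset as) {\<rho>. ?out as \<rho> \<in> S}"
    proof -
      have "map (\<lambda>a. map_pmf (obs a)
          (pmf_of_set (permutations_of_multiset {#x \<in># E - mset as. x \<in> cl a#}))) as = map kern as"
        by (auto simp: kern_def flt simp del: filter_diff_mset)
      then have "sequence_pmf (map kern as) =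
          map_pmf (?out as) (pmf_of_set (permutations_of_multiset (E - mset as)))"
        using random_permutation_filters_independent[of cl as obs "E - mset as"] g
        by (simp only: good_def)
      then show ?thesis by (simp add: vimage_def)
    qed
    ultimately show ?thesis
      using random_permutation_prefix_ge[OF dist sub order_refl] by simp
  qed
  have "measure_pmf.prob (replicate_pmf r (bind_pmf (pmf_of_multiset E) kern)) S =
      measure_pmf.expectation ?J ?ps"
    by (simp add: replicate_bind_pmf_eq_sequence measure_bind_pmf)
  also have "\<dots> = (\<Sum>as\<in>set_pmf ?J. ?ps as * pmf ?J as)"
    using finJ by (intro integral_measure_pmf_real) auto
  also have "\<dots> \<le> (\<Sum>as\<in>set_pmf ?J. (if as \<in> Good then pmf ?J as * ?ps as else 0) +
      (if good as then 0 else pmf ?J as))"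
    by (intro sum_mono) (auto simp: Good_def mult_left_le_one_le)
  also have "\<dots> = (\<Sum>as\<in>Good. pmf ?J as * ?ps as) + (\<Sum>as\<in>{as\<in>set_pmf ?J. \<not> good as}. pmf ?J as)"
    using finJ by (auto simp: sum.distrib Good_def sum.inter_filter intro!: sum.cong)
  also have "(\<Sum>as\<in>{as\<in>set_pmf ?J. \<not> good as}. pmf ?J as) = measure_pmf.prob ?J {as. \<not> good as}"
    using finJ by (simp add: measure_measure_pmf_finite[symmetric] Int_def conj_commute
        flip: measure_Int_set_pmf[of _ "{as. \<not> good as}"])
  also have "(\<Sum>as\<in>Good. pmf ?J as * ?ps as) \<le> (\<Sum>as\<in>Good. ?pr E (?A as))"
    by (intro sum_mono key)
  \<comment> \<open>All these prefixes have length \<open>r\<close>, so the events are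
    disjoint.\<close>
  also have "\<dots> = ?pr E (\<Union>as\<in>Good. ?A as)"
    using finG by (intro measure_pmf.finite_measure_finite_Union[symmetric])
       (auto simp: disjoint_family_on_def Good_def setJ)
  also have "\<dots> \<le> ?pr E {\<pi>. length \<pi> \<ge> r \<and> good (take r \<pi>) \<and> ?out (take r \<pi>) (drop r \<pi>) \<in> S}"
    by (intro measure_pmf.finite_measure_mono) (auto simp: Good_def setJ)
  finally show ?thesis by simp
qed

text \<open>Union bound over pairs of positions. The factor \<open>r * r\<close> is a crude count of
  the pairs that passes through the induction, since
  \<open>r + r * r \<le> (r + 1) * (r + 1)\<close>.\<close>

lemma prob_replicate_pmf_conflict_le:
  fixes R :: "'a \<Rightarrow> 'a \<Rightarrow> bool"
  assumes R: "\<And>a. a \<in> set_pmf p \<Longrightarrow> measure_pmf.prob p {b. \<not> R a b} \<le> c" and c: "c \<ge> 0"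
  shows "measure_pmf.prob (replicate_pmf r p) {as. \<not> sorted_wrt R as} \<le> r * r * c"
proof -
  have one: "measure_pmf.prob (replicate_pmf r p) {as. \<exists>b\<in>set as. \<not> R a b} \<le> r * c"
    if "a \<in> set_pmf p" for a r
  proof (induction r)
    case 0
    then show ?case by simp
  next
    case (Suc r)
    have "replicate_pmf (Suc r) p = map_pmf (\<lambda>(x, xs). x # xs) (pair_pmf p (replicate_pmf r p))"
      by (simp add: pair_pmf_def map_bind_pmf)
    then have "measure_pmf.prob (replicate_pmf (Suc r) p) {as. \<exists>b\<in>set as. \<not> R a b} =
      measure_pmf.prob (pair_pmf p (replicate_pmf r p))
        (fst -` {b. \<not> R a b} \<union> snd -` {as. \<exists>b\<in>set as. \<not> R a b})"
      by (auto intro!: arg_cong[where f = "measure _"])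
    also have "\<dots> \<le> measure_pmf.prob (map_pmf fst (pair_pmf p (replicate_pmf r p))) {b. \<not> R a b} +
        measure_pmf.prob (map_pmf snd (pair_pmf p (replicate_pmf r p))) {as. \<exists>b\<in>set as. \<not> R a b}"
      unfolding measure_map_pmf by (intro measure_Un_le) auto
    also have "\<dots> \<le> c + r * c"
      using R[OF that] Suc by (simp add: map_fst_pair_pmf map_snd_pair_pmf)
    finally show ?case by (simp add: algebra_simps)
  qed
  show ?thesis
  proof (induction r)
    case 0
    then show ?case by simp
  next
    case (Suc r)
    have "replicate_pmf (Suc r) p = bind_pmf p (\<lambda>a. map_pmf ((#) a) (replicate_pmf r p))"
      by (simp add: map_pmf_def)
    then have "measure_pmf.prob (replicate_pmf (Suc r) p) {as. \<not> sorted_wrt R as} =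
      measure_pmf.expectation p (\<lambda>a. measure_pmf.prob (replicate_pmf r p)
        {as. \<not> ((\<forall>b\<in>set as. R a b) \<and> sorted_wrt R as)})"
      by (simp add: measure_bind_pmf vimage_def)
    also have "\<dots> \<le> measure_pmf.expectation p (\<lambda>a. r * c + r * r * c)"
    proof (intro integral_mono_AE AE_pmfI)
      show "integrable (measure_pmf p) (\<lambda>a. measure_pmf.prob (replicate_pmf r p)
          {as. \<not> ((\<forall>b\<in>set as. R a b) \<and> sorted_wrt R as)})"
        by (intro measure_pmf.integrable_const_bound[where B = 1]) auto
      fix a assume a: "a \<in> set_pmf p"
      have "measure_pmf.prob (replicate_pmf r p) {as. \<not> ((\<forall>b\<in>set as. R a b) \<and> sorted_wrt R as)} \<le>
        measure_pmf.prob (replicate_pmf r p) ({as. \<exists>b\<in>set as. \<not> R a b} \<union> {as. \<not> sorted_wrt R as})"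
        by (intro measure_pmf.finite_measure_mono) auto
      also have "\<dots> \<le> measure_pmf.prob (replicate_pmf r p) {as. \<exists>b\<in>set as. \<not> R a b} +
          measure_pmf.prob (replicate_pmf r p) {as. \<not> sorted_wrt R as}"
        by (intro measure_Un_le) auto
      also have "\<dots> \<le> r * c + r * r * c" using one[OF a] Suc by (auto intro: add_mono)
      finally show "measure_pmf.prob (replicate_pmf r p)
          {as. \<not> ((\<forall>b\<in>set as. R a b) \<and> sorted_wrt R as)} \<le> r * c + r * r * c" .
    qed auto
    also have "\<dots> \<le> Suc r * Suc r * c" using c by (simp add: algebra_simps)
    finally show ?case by (simp only: of_nat_mult)
  qed
qed

section \<open>Concentration of frequencies and inversion of a triangular kernel\<close>

lemma prob_frequency_deviation_le:
  assumes "r > 0" and "\<eta> \<ge> 0"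
  shows "measure_pmf.prob (replicate_pmf r q)
     {os. \<bar>count_list os \<sigma> / r - pmf q \<sigma>\<bar> \<ge> \<eta>} \<le> 2 * exp (- 2 * real r * \<eta>\<^sup>2)"
proof -
  let ?p = "pmf q \<sigma>"
  interpret binomial_distribution r ?p by unfold_locales (auto simp: pmf_le_1)
  have bern: "map_pmf (\<lambda>x. x = \<sigma>) q = bernoulli_pmf ?p"
  proof (rule pmf_eqI)
    fix b
    have "pmf (map_pmf (\<lambda>x. x = \<sigma>) q) True = ?p"
      by (simp add: pmf_map vimage_def measure_pmf_single)
    moreover have "pmf (map_pmf (\<lambda>x. x = \<sigma>) q) False = 1 - ?p"
    proof -
      have "(\<lambda>x. x = \<sigma>) -` {False} = - {\<sigma>}" by auto
      then show ?thesis
        using measure_pmf.prob_compl[of "{\<sigma>}" q] by (simp add: pmf_map measure_pmf_single Compl_eq_Diff_UNIV)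
    qed
    ultimately show "pmf (map_pmf (\<lambda>x. x = \<sigma>) q) b = pmf (bernoulli_pmf ?p) b"
      by (cases b) (auto simp: pmf_le_1)
  qed
  have rep: "replicate_pmf n (map_pmf f q) = map_pmf (map f) (replicate_pmf n q)"
    for n and f :: "'a \<Rightarrow> bool"
    by (induction n) (auto simp: map_pmf_def bind_assoc_pmf bind_return_pmf)
  have cl: "length (filter (\<lambda>x. x = \<sigma>) os) = count_list os \<sigma>" for os :: "'a list"
    by (induction os) auto
  \<comment> \<open>Occurrences of \<open>\<sigma>\<close> are the successes in \<open>r\<close>
    independent trials, so Hoeffding's inequality for binomial laws applies.\<close>
  have "binomial_pmf r ?p = map_pmf (length \<circ> filter id) (replicate_pmf r (bernoulli_pmf ?p))"
    by (rule binomial_pmf_altdef) (auto simp: pmf_le_1)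
  also have "\<dots> = map_pmf (\<lambda>os. count_list os \<sigma>) (replicate_pmf r q)"
    by (simp flip: bern add: rep map_pmf_comp o_def filter_map cl)
  finally have "binomial_pmf r ?p = map_pmf (\<lambda>os. count_list os \<sigma>) (replicate_pmf r q)" .
  then show ?thesis using prob_abs_ge'[OF assms] by (simp add: vimage_def)
qed

lemma prob_frequencies_deviation_le:
  assumes "finite Ty" and "r > 0" and "\<eta> \<ge> 0"
  shows "measure_pmf.prob (replicate_pmf r q)
     {os. \<not> (\<forall>\<sigma>\<in>Ty. \<bar>count_list os \<sigma> / r - pmf q \<sigma>\<bar> \<le> \<eta>)} \<le> card Ty * (2 * exp (- 2 * real r * \<eta>\<^sup>2))"
proof -
  let ?B = "\<lambda>\<sigma>. {os. \<bar>count_list os \<sigma> / r - pmf q \<sigma>\<bar> \<ge> \<eta>}"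
  have "measure_pmf.prob (replicate_pmf r q)
     {os. \<not> (\<forall>\<sigma>\<in>Ty. \<bar>count_list os \<sigma> / r - pmf q \<sigma>\<bar> \<le> \<eta>)} \<le>
     measure_pmf.prob (replicate_pmf r q) (\<Union>\<sigma>\<in>Ty. ?B \<sigma>)"
    by (intro measure_pmf.finite_measure_mono) auto
  also have "\<dots> \<le> (\<Sum>\<sigma>\<in>Ty. measure_pmf.prob (replicate_pmf r q) (?B \<sigma>))"
    using assms by (intro measure_pmf.finite_measure_subadditive_finite) auto
  also have "\<dots> \<le> (\<Sum>\<sigma>\<in>Ty. 2 * exp (- 2 * real r * \<eta>\<^sup>2))"
    using assms by (intro sum_mono prob_frequency_deviation_le)
  finally show ?thesis by simp
qed

text \<open>Back substitution from the largest rank downwards. The induction runs over sets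
  \<open>T\<close> that are upward closed in rank: removing a member \<open>\<sigma>\<close> of
  minimal rank keeps them closed, and the equation for \<open>\<sigma>\<close> involves
  \<open>z\<close> on \<open>T\<close> only. Division is by the diagonal entry alone; all other
  entries are at most 1.\<close>

lemma triangular_kernel_robustly_invertible:
  fixes M :: "'a \<Rightarrow> 'a pmf" and rank :: "'a \<Rightarrow> nat"
  assumes fin: "finite Ty"
    and diag: "\<And>\<tau>. \<tau> \<in> Ty \<Longrightarrow> pmf (M \<tau>) \<tau> > 0"
    and tri: "\<And>\<sigma> \<tau>. \<tau> \<in> Ty \<Longrightarrow> \<sigma> \<in> Ty \<Longrightarrow> pmf (M \<tau>) \<sigma> \<noteq> 0 \<Longrightarrow> \<sigma> = \<tau> \<or> rank \<sigma> < rank \<tau>"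
  obtains c :: real where "c \<ge> 0" and
    "\<And>z \<eta>. (\<And>\<sigma>. \<sigma> \<in> Ty \<Longrightarrow> \<bar>\<Sum>\<tau>\<in>Ty. pmf (M \<tau>) \<sigma> * z \<tau>\<bar> \<le> \<eta>) \<Longrightarrow> (\<Sum>\<tau>\<in>Ty. \<bar>z \<tau>\<bar>) \<le> c * \<eta>"
proof -
  have step: "\<exists>c\<ge>0. \<forall>(z :: 'a \<Rightarrow> real) \<eta>.
      (\<forall>\<sigma>\<in>Ty. \<bar>\<Sum>\<tau>\<in>Ty. pmf (M \<tau>) \<sigma> * z \<tau>\<bar> \<le> \<eta>) \<longrightarrow> (\<Sum>\<tau>\<in>T. \<bar>z \<tau>\<bar>) \<le> c * \<eta>"
    if "T \<subseteq> Ty" and "\<And>\<sigma> \<tau>. \<sigma> \<in> T \<Longrightarrow> \<tau> \<in> Ty \<Longrightarrow> rank \<sigma> < rank \<tau> \<Longrightarrow> \<tau> \<in> T" for T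
    using finite_subset[OF that(1) fin] that
  proof (induction "card T" arbitrary: T)
    case 0
    then show ?case by (intro exI[of _ 0]) auto
  next
    case (Suc N)
    have "T \<noteq> {}" using Suc by auto
    then obtain \<sigma> where \<sigma>: "\<sigma> \<in> T" "\<And>\<tau>. \<tau> \<in> T \<Longrightarrow> rank \<sigma> \<le> rank \<tau>"
      using arg_min_if_finite[OF \<open>finite T\<close>, of rank] by (meson not_le)
    let ?T = "T - {\<sigma>}"
    have "\<exists>c\<ge>0. \<forall>(z :: 'a \<Rightarrow> real) \<eta>.
      (\<forall>\<sigma>\<in>Ty. \<bar>\<Sum>\<tau>\<in>Ty. pmf (M \<tau>) \<sigma> * z \<tau>\<bar> \<le> \<eta>) \<longrightarrow> (\<Sum>\<tau>\<in>?T. \<bar>z \<tau>\<bar>) \<le> c * \<eta>"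
    proof (rule Suc.hyps(1))
      show "\<tau> \<in> ?T" if "\<sigma>' \<in> ?T" "\<tau> \<in> Ty" "rank \<sigma>' < rank \<tau>" for \<sigma>' \<tau>
        using that \<sigma> Suc.prems(3)[of \<sigma>' \<tau>] by force
    qed (use Suc \<sigma> in auto)
    then obtain c where c: "c \<ge> 0" and c': "\<And>(z :: 'a \<Rightarrow> real) \<eta>.
      (\<forall>\<sigma>\<in>Ty. \<bar>\<Sum>\<tau>\<in>Ty. pmf (M \<tau>) \<sigma> * z \<tau>\<bar> \<le> \<eta>) \<Longrightarrow> (\<Sum>\<tau>\<in>?T. \<bar>z \<tau>\<bar>) \<le> c * \<eta>" by blast
    have sTy: "\<sigma> \<in> Ty" using \<sigma> Suc.prems by auto
    define p where "p = pmf (M \<sigma>) \<sigma>"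
    have p: "p > 0" using diag[OF sTy] by (simp add: p_def)
    \<comment> \<open>The equation for \<open>\<sigma>\<close> gives
      \<open>\<bar>z \<sigma>\<bar> \<le> (1 + c) * \<eta> / p\<close>; the remaining entries
      contribute \<open>c * \<eta>\<close>.\<close>
    have "(\<Sum>\<tau>\<in>T. \<bar>z \<tau>\<bar>) \<le> ((1 + c) / p + c) * \<eta>"
      if h: "\<forall>\<sigma>\<in>Ty. \<bar>\<Sum>\<tau>\<in>Ty. pmf (M \<tau>) \<sigma> * z \<tau>\<bar> \<le> \<eta>" for z :: "'a \<Rightarrow> real" and \<eta>
    proof -
      have "(\<Sum>\<tau>\<in>Ty. pmf (M \<tau>) \<sigma> * z \<tau>) = (\<Sum>\<tau>\<in>T. pmf (M \<tau>) \<sigma> * z \<tau>)"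
      proof (rule sum.mono_neutral_right)
        show "\<forall>\<tau>\<in>Ty - T. pmf (M \<tau>) \<sigma> * z \<tau> = 0"
          using tri[OF _ sTy] \<sigma> Suc.prems(3)[OF \<sigma>(1)] by auto
      qed (use fin Suc.prems in auto)
      also have "\<dots> = p * z \<sigma> + (\<Sum>\<tau>\<in>?T. pmf (M \<tau>) \<sigma> * z \<tau>)"
        using \<sigma> Suc.prems by (simp add: sum.remove p_def)
      finally have "p * z \<sigma> = (\<Sum>\<tau>\<in>Ty. pmf (M \<tau>) \<sigma> * z \<tau>) - (\<Sum>\<tau>\<in>?T. pmf (M \<tau>) \<sigma> * z \<tau>)" by simp
      then have "\<bar>p * z \<sigma>\<bar> \<le> \<eta> + \<bar>\<Sum>\<tau>\<in>?T. pmf (M \<tau>) \<sigma> * z \<tau>\<bar>"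
        using bspec[OF h sTy] by linarith
      also have "\<bar>\<Sum>\<tau>\<in>?T. pmf (M \<tau>) \<sigma> * z \<tau>\<bar> \<le> (\<Sum>\<tau>\<in>?T. \<bar>z \<tau>\<bar>)"
        by (rule order_trans[OF sum_abs sum_mono]) (auto simp: abs_mult pmf_le_1 intro: mult_left_le_one_le)
      also have "\<dots> \<le> c * \<eta>" using c' h by blast
      finally have "\<bar>z \<sigma>\<bar> \<le> (1 + c) * \<eta> / p"
        using p by (simp add: abs_mult field_simps)
      moreover have "(\<Sum>\<tau>\<in>?T. \<bar>z \<tau>\<bar>) \<le> c * \<eta>" using c' h by blast
      moreover have "(\<Sum>\<tau>\<in>T. \<bar>z \<tau>\<bar>) = \<bar>z \<sigma>\<bar> + (\<Sum>\<tau>\<in>?T. \<bar>z \<tau>\<bar>)"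
        using \<sigma> Suc.prems by (simp add: sum.remove)
      ultimately show ?thesis by (simp add: algebra_simps)
    qed
    then show ?case using c p by (intro exI[of _ "(1 + c) / p + c"]) auto
  qed
  show ?thesis using step[of Ty] that by auto
qed

section \<open>Balls and exploration\<close>

text \<open>As a relation, so that paths of length \<open>L\<close> become the power
  \<open>adj E ^^ L\<close>.\<close>

definition adj :: "edge multiset \<Rightarrow> nat rel" where
  "adj E = {(x, y). (x, y) \<in># E \<or> (y, x) \<in># E}"

definition ends :: "edge \<Rightarrow> nat set" where
  "ends e = {fst e, snd e}"

definition verts :: "edge multiset \<Rightarrow> nat set" where
  "verts E = (\<Union>e\<in>set_mset E. ends e)"

definition ball_of :: "edge multiset \<Rightarrow> nat \<Rightarrow> nat \<Rightarrow> nat set" where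
  "ball_of E l y = {x. \<exists>L\<le>l. (x, y) \<in> adj E ^^ L}"

text \<open>Counterpart of \<open>edge_ball\<close> without a vertex set. It also makes sense for a
  bare list of collected edges and is monotone in the edges.\<close>

definition gball :: "edge multiset \<Rightarrow> nat \<Rightarrow> edge \<Rightarrow> nat set" where
  "gball E l e = (\<Union>y\<in>ends e. ball_of E l y)"

lemma finite_ends [simp]: "finite (ends e)" by (simp add: ends_def)

lemma finite_verts [simp]: "finite (verts E)" by (simp add: verts_def)

lemma verts_mono: "set_mset E \<subseteq> set_mset E' \<Longrightarrow> verts E \<subseteq> verts E'"
  by (auto simp: verts_def)

lemma relpow_mono_rel:
  fixes R S :: "'a rel"
  assumes "R \<subseteq> S" shows "R ^^ n \<subseteq> S ^^ n"
  using assms by (induction n) auto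

lemma adj_mono: "set_mset E \<subseteq> set_mset E' \<Longrightarrow> adj E \<subseteq> adj E'"
  by (auto simp: adj_def)

lemma adj_sym: "(x, y) \<in> adj E \<longleftrightarrow> (y, x) \<in> adj E"
  by (auto simp: adj_def)

lemma adj_relpow_sym:
  assumes "(x, y) \<in> adj E ^^ L" shows "(y, x) \<in> adj E ^^ L"
  using assms
proof (induction L arbitrary: y)
  case (Suc L)
  then show ?case by (metis adj_sym relpow_Suc_E relpow_Suc_I2)
qed auto

lemma adj_verts: "(x, y) \<in> adj E \<Longrightarrow> x \<in> verts E \<and> y \<in> verts E"
  by (force simp: adj_def verts_def ends_def)

lemma gball_mono: "set_mset E \<subseteq> set_mset E' \<Longrightarrow> gball E l e \<subseteq> gball E' l e"
  using relpow_mono_rel[OF adj_mono, of E E'] by (force simp: gball_def ball_of_def)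

lemma ends_subset_gball: "ends e \<subseteq> gball E l e"
proof
  fix x assume "x \<in> ends e"
  moreover have "(x, x) \<in> adj E ^^ 0" by simp
  ultimately show "x \<in> gball E l e" unfolding gball_def ball_of_def by blast
qed

lemma gball_subset: "gball E l e \<subseteq> ends e \<union> verts E"
proof
  fix x assume "x \<in> gball E l e"
  then obtain L y where "y \<in> ends e" "(x, y) \<in> adj E ^^ L" by (auto simp: gball_def ball_of_def)
  then show "x \<in> ends e \<union> verts E"
    by (cases L) (auto simp del: relpow.simps(2) dest!: relpow_Suc_D2 adj_verts)
qed

lemma finite_gball [simp]: "finite (gball E l e)"
  by (rule finite_subset[OF gball_subset]) simp

lemma path_between_iff: "path_between (V, E) L u v \<longleftrightarrow> (u, v) \<in> adj E ^^ L"
proof -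
  have *: "(\<forall>i\<in>{1..L}. P (w (i - 1)) (w i)) \<longleftrightarrow> (\<forall>i<L. P (w i) (w (Suc i)))"
    for P and w :: "nat \<Rightarrow> nat"
  proof
    assume h: "\<forall>i\<in>{1..L}. P (w (i - 1)) (w i)"
    show "\<forall>i<L. P (w i) (w (Suc i))"
    proof (intro allI impI)
      fix i assume "i < L"
      then show "P (w i) (w (Suc i))" using bspec[OF h, of "Suc i"] by auto
    qed
  next
    assume h: "\<forall>i<L. P (w i) (w (Suc i))"
    show "\<forall>i\<in>{1..L}. P (w (i - 1)) (w i)"
    proof
      fix i assume "i \<in> {1..L}"
      then show "P (w (i - 1)) (w i)" using spec[OF h, of "i - 1"] by auto
    qed
  qed
  show ?thesis
    unfolding relpow_fun_conv path_between_def prod.case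
    using *[of "\<lambda>x y. (x, y) \<in> adj E"] by (simp add: adj_def)
qed

lemma edge_ball_eq_gball:
  assumes "verts E \<subseteq> V" and "ends e \<subseteq> V"
  shows "edge_ball (V, E) l e = gball E l e"
proof -
  have "edge_ball (V, E) l e = V \<inter> gball E l e"
    by (cases e) (auto simp: edge_ball_def vertex_ball_def path_between_iff gball_def ends_def ball_of_def)
  then show ?thesis using gball_subset[of E l e] assms by auto
qed

text \<open>Every vertex on a path of length at most \<open>l\<close> to the root is itself that
  close to the root, so the path survives in the induced subgraph. Hence a neighborhood, taken as a
  graph of its own, still has all vertices near its root.\<close>

lemma gball_restrict:
  "gball {#e \<in># E. ends e \<subseteq> gball E l a#} l a = gball E l a"
proof
  let ?N = "gball E l a" let ?F = "{#e \<in># E. ends e \<subseteq> ?N#}"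
  show "gball ?F l a \<subseteq> ?N" by (rule gball_mono) auto
  have "(x, y) \<in> adj ?F ^^ L" if "L \<le> l" "y \<in> ends a" "(x, y) \<in> adj E ^^ L" for L x y
    using that
  proof (induction L arbitrary: x)
    case (Suc L)
    then obtain z where z: "(x, z) \<in> adj E" "(z, y) \<in> adj E ^^ L" by (metis relpow_Suc_D2)
    have "x \<in> ?N" unfolding gball_def ball_of_def using Suc.prems by blast
    moreover have "z \<in> ?N" unfolding gball_def ball_of_def using Suc.prems z Suc_leD by blast
    ultimately have "(x, z) \<in> adj ?F" using z by (auto simp: adj_def ends_def)
    moreover have "(z, y) \<in> adj ?F ^^ L" using Suc z by auto
    ultimately show ?case by (rule relpow_Suc_I2)
  qed auto
  then show "?N \<subseteq> gball ?F l a" by (fastforce simp: gball_def ball_of_def)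
qed

section \<open>Counting under a degree bound\<close>

lemma size_filter_mset_Bex_le:
  assumes "finite X"
  shows "size {#b \<in># E. \<exists>x\<in>X. P x b#} \<le> (\<Sum>x\<in>X. size {#b \<in># E. P x b#})"
  using assms
proof induction
  case (insert x X)
  have "size {#b \<in># E. \<exists>x\<in>insert x X. P x b#} \<le> size ({#b \<in># E. P x b#} + {#b \<in># E. \<exists>x\<in>X. P x b#})"
    by (rule size_mset_mono) (auto simp: subseteq_mset_def)
  then show ?case using insert by simp
qed simp

text \<open>Free of a vertex set, so that it passes to every sub-multiset of edges.\<close>

definition deg_le :: "nat \<Rightarrow> edge multiset \<Rightarrow> bool" where
  "deg_le D E \<longleftrightarrow> (\<forall>v. size {#e \<in># E. v \<in> ends e#} \<le> D)"

lemma degree_bounded_iff_deg_le: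
  assumes "verts E \<subseteq> V"
  shows "degree_bounded D (V, E) \<longleftrightarrow> deg_le D E"
proof -
  have *: "vertex_degree (V, E) v = size {#e \<in># E. v \<in> ends e#}" for v
    by (auto simp: vertex_degree_def ends_def eq_commute intro!: arg_cong[where f = size] filter_mset_cong)
  have **: "{#e \<in># E. v \<in> ends e#} = {#}" if "v \<notin> V" for v
    using that assms by (intro multiset_eqI) (force simp: verts_def not_in_iff[symmetric])
  have "size {#e \<in># E. v \<in> ends e#} \<le> D" if "v \<notin> V" for v unfolding **[OF that] by simp
  then show ?thesis unfolding degree_bounded_def deg_le_def by (auto simp: *)
qed

lemma deg_le_mono:
  assumes "deg_le D E" and "F \<subseteq># E"
  shows "deg_le D F"
  unfolding deg_le_def
proof
  fix v
  have "size {#e \<in># F. v \<in> ends e#} \<le> size {#e \<in># E. v \<in> ends e#}"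
    by (intro size_mset_mono multiset_filter_mono assms)
  then show "size {#e \<in># F. v \<in> ends e#} \<le> D"
    using assms(1) by (auto simp: deg_le_def intro: order_trans)
qed

lemma size_incident_le:
  assumes "deg_le D E" and "finite X"
  shows "size {#e \<in># E. \<exists>x\<in>X. x \<in> ends e#} \<le> D * card X"
proof -
  have "size {#e \<in># E. \<exists>x\<in>X. x \<in> ends e#} \<le> (\<Sum>x\<in>X. size {#e \<in># E. x \<in> ends e#})"
    by (rule size_filter_mset_Bex_le[OF assms(2)])
  also have "\<dots> \<le> (\<Sum>x\<in>X. D)" using assms(1) by (intro sum_mono) (auto simp: deg_le_def)
  finally show ?thesis by (simp add: mult.commute)
qed

lemma size_edges_le:
  assumes "deg_le D F" and "verts F \<subseteq> X" and "finite X"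
  shows "size F \<le> D * card X"
proof -
  have "{#e \<in># F. \<exists>x\<in>X. x \<in> ends e#} = F"
    using assms(2) by (force simp: filter_mset_eq_conv verts_def ends_def)
  then show ?thesis using size_incident_le[OF assms(1,3)] by simp
qed

lemma finite_neighbors: "finite {x. (x, y) \<in> adj E}"
  by (rule finite_subset[of _ "verts E"]) (auto dest: adj_verts)

lemma card_neighbors_le:
  assumes "deg_le D E"
  shows "card {x. (x, y) \<in> adj E} \<le> D"
proof -
  let ?F = "{#e \<in># E. y \<in> ends e#}"
  let ?f = "\<lambda>e. if fst e = y then snd e else fst e"
  have "{x. (x, y) \<in> adj E} \<subseteq> ?f ` set_mset ?F"
    by (force simp: adj_def ends_def)
  then have "card {x. (x, y) \<in> adj E} \<le> card (?f ` set_mset ?F)" by (intro card_mono) auto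
  also have "\<dots> \<le> card (set_mset ?F)" by (rule card_image_le) simp
  also have "\<dots> = (\<Sum>e\<in>set_mset ?F. 1)" by simp
  also have "\<dots> \<le> (\<Sum>e\<in>set_mset ?F. count ?F e)"
    by (rule sum_mono) (metis One_nat_def Suc_leI count_greater_zero_iff)
  also have "\<dots> = size ?F" by (simp only: size_multiset_overloaded_eq)
  finally show ?thesis using assms by (auto simp: deg_le_def intro: order_trans)
qed

lemma finite_ball_of [simp]: "finite (ball_of E l y)"
proof (rule finite_subset)
  show "ball_of E l y \<subseteq> gball E l (y, y)" by (auto simp: gball_def ends_def)
qed simp

lemma card_ball_of_le:
  assumes "deg_le D E"
  shows "card (ball_of E l y) \<le> (D + 1) ^ l"
proof (induction l)
  case 0
  then show ?case by (simp add: ball_of_def)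
next
  case (Suc l)
  let ?nb = "\<lambda>z. insert z {x. (x, z) \<in> adj E}"
  have "ball_of E (Suc l) y \<subseteq> (\<Union>z\<in>ball_of E l y. ?nb z)"
  proof
    fix x assume "x \<in> ball_of E (Suc l) y"
    then obtain L where L: "L \<le> Suc l" "(x, y) \<in> adj E ^^ L" by (auto simp: ball_of_def)
    show "x \<in> (\<Union>z\<in>ball_of E l y. ?nb z)"
    proof (cases "L \<le> l")
      case True then show ?thesis using L by (auto simp: ball_of_def)
    next
      case False
      then have "L = Suc l" using L by simp
      then obtain z where "(x, z) \<in> adj E" "(z, y) \<in> adj E ^^ l" using L by (metis relpow_Suc_D2)
      then show ?thesis by (auto simp: ball_of_def)
    qed
  qed
  then have "card (ball_of E (Suc l) y) \<le> card (\<Union>z\<in>ball_of E l y. ?nb z)"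
    by (intro card_mono) (auto simp: finite_neighbors)
  also have "\<dots> \<le> (\<Sum>z\<in>ball_of E l y. card (?nb z))" by (rule card_UN_le) simp
  also have "\<dots> \<le> (\<Sum>z\<in>ball_of E l y. D + 1)"
  proof (rule sum_mono)
    fix z show "card (?nb z) \<le> D + 1"
      using card_insert_le_m1[of "D + 1" "{x. (x, z) \<in> adj E}" z] card_neighbors_le[OF assms, of z] by simp
  qed
  also have "\<dots> \<le> (D + 1) ^ Suc l" using Suc by (simp del: add_Suc_right)
  finally show ?case .
qed

definition ball_bound :: "nat \<Rightarrow> nat \<Rightarrow> nat" where
  "ball_bound l D = 2 * (D + 1) ^ l"

lemma card_gball_le:
  assumes "deg_le D E"
  shows "card (gball E l e) \<le> ball_bound l D"
proof -
  have "gball E l e = ball_of E l (fst e) \<union> ball_of E l (snd e)" by (auto simp: gball_def ends_def)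
  then have "card (gball E l e) \<le> card (ball_of E l (fst e)) + card (ball_of E l (snd e))"
    by (simp add: card_Un_le)
  then show ?thesis
    using card_ball_of_le[OF assms, of l "fst e"] card_ball_of_le[OF assms, of l "snd e"]
    by (simp add: ball_bound_def)
qed

text \<open>Count through a common vertex \<open>x\<close>: the ball of \<open>a\<close> offers at
  most \<open>ball_bound l D\<close> of them, and an edge whose ball contains \<open>x\<close> has,
  by symmetry of distance, an endpoint in the ball around \<open>x\<close>.\<close>

lemma size_conflict_le:
  assumes "deg_le D E"
  shows "size {#b \<in># E. gball E l a \<inter> gball E l b \<noteq> {}#} \<le> ball_bound l D * (D * (D + 1) ^ l)"
proof -
  have one: "size {#b \<in># E. x \<in> gball E l b#} \<le> D * (D + 1) ^ l" for x
  proof -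
    have "{#b \<in># E. x \<in> gball E l b#} \<subseteq># {#b \<in># E. \<exists>y\<in>ball_of E l x. y \<in> ends b#}"
      by (intro filter_mset_mono_strong) (auto simp: gball_def ball_of_def dest: adj_relpow_sym)
    then have "size {#b \<in># E. x \<in> gball E l b#} \<le> D * card (ball_of E l x)"
      using size_incident_le[OF assms, of "ball_of E l x"] size_mset_mono by fastforce
    then show ?thesis using card_ball_of_le[OF assms, of l x] by (meson le_trans mult_le_mono2)
  qed
  have "{#b \<in># E. gball E l a \<inter> gball E l b \<noteq> {}#} = {#b \<in># E. \<exists>x\<in>gball E l a. x \<in> gball E l b#}"
    by (auto intro!: filter_mset_cong)
  then have "size {#b \<in># E. gball E l a \<inter> gball E l b \<noteq> {}#} \<le>
      (\<Sum>x\<in>gball E l a. size {#b \<in># E. x \<in> gball E l b#})"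
    using size_filter_mset_Bex_le[of "gball E l a"] by simp
  also have "\<dots> \<le> (\<Sum>x\<in>gball E l a. D * (D + 1) ^ l)" by (intro sum_mono one)
  also have "\<dots> \<le> ball_bound l D * (D * (D + 1) ^ l)"
    using card_gball_le[OF assms, of l a] by simp
  finally show ?thesis .
qed

text \<open>Distances in the part collected so far are at least the true ones, so an accepted edge lies in
  the true neighborhood of the root, which is the head of the list.\<close>

definition grow :: "nat \<Rightarrow> edge \<Rightarrow> edge list \<Rightarrow> edge list" where
  "grow l e ob = (if ends e \<subseteq> gball (mset (ob @ [e])) l (hd ob) then ob @ [e] else ob)"

abbreviation explore :: "nat \<Rightarrow> edge \<Rightarrow> edge list \<Rightarrow> edge list" where
  "explore l a w \<equiv> fold (grow l) w [a]"

lemma grow_nonempty: "ob \<noteq> [] \<Longrightarrow> grow l e ob \<noteq> [] \<and> hd (grow l e ob) = hd ob"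
  by (simp add: grow_def)

lemma fold_grow_hd: "ob \<noteq> [] \<Longrightarrow> fold (grow l) w ob \<noteq> [] \<and> hd (fold (grow l) w ob) = hd ob"
  by (induction w arbitrary: ob) (auto simp: grow_nonempty)

lemma mset_fold_grow: "mset (fold (grow l) w ob) \<subseteq># mset ob + mset w"
proof (induction w arbitrary: ob)
  case (Cons e w)
  have "mset (grow l e ob) \<subseteq># mset ob + {#e#}" by (simp add: grow_def)
  then have "mset (grow l e ob) + mset w \<subseteq># mset ob + {#e#} + mset w"
    by (rule subset_mset.add_right_mono)
  then have "mset (fold (grow l) w (grow l e ob)) \<subseteq># mset ob + {#e#} + mset w"
    using Cons[of "grow l e ob"] by (rule subset_mset.order_trans[rotated])
  then show ?case by simp
qed simp

lemma explore_hd [simp]: "explore l a w \<noteq> []" "hd (explore l a w) = a"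
  using fold_grow_hd[of "[a]" l w] by auto

lemma mset_explore: "mset (explore l a w) \<subseteq># add_mset a (mset w)"
  using mset_fold_grow[of l w "[a]"] by simp

text \<open>An edge is tested against the collected part including that edge, and balls only grow.
  So all collected vertices are within \<open>l\<close> of the root inside the collected part
  itself, which makes an observation a legitimate type.\<close>

lemma verts_fold_grow:
  assumes "ob \<noteq> []" and "verts (mset ob) \<subseteq> gball (mset ob) l (hd ob)"
  shows "verts (mset (fold (grow l) w ob)) \<subseteq> gball (mset (fold (grow l) w ob)) l (hd ob)"
  using assms
proof (induction w arbitrary: ob)
  case (Cons e w)
  have "gball (mset ob) l (hd ob) \<subseteq> gball (mset (ob @ [e])) l (hd ob)" by (rule gball_mono) auto
  then have "verts (mset (grow l e ob)) \<subseteq> gball (mset (grow l e ob)) l (hd ob)"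
    using Cons.prems by (auto simp: grow_def verts_def)
  then show ?case using Cons.IH[of "grow l e ob"] Cons.prems grow_nonempty[of ob l e] by simp
qed simp

lemma verts_explore: "verts (mset (explore l a w)) \<subseteq> gball (mset (explore l a w)) l a"
  using verts_fold_grow[of "[a]" l w] ends_subset_gball[of a "{#a#}" l] by (simp add: verts_def)

text \<open>Edges outside the true neighborhood are rejected anyway. An observation is therefore a
  function of the order of the neighborhood's edges alone, as the independence argument
  requires.\<close>

lemma fold_grow_filter:
  assumes "ob \<noteq> []" and "set ob \<subseteq> set_mset E" and "set w \<subseteq> set_mset E"
  shows "fold (grow l) w ob = fold (grow l) (filter (\<lambda>e. ends e \<subseteq> gball E l (hd ob)) w) ob"
  using assms
proof (induction w arbitrary: ob)
  case (Cons e w)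
  show ?case
  proof (cases "ends e \<subseteq> gball E l (hd ob)")
    case True
    have "set (grow l e ob) \<subseteq> set_mset E" using Cons.prems by (auto simp: grow_def)
    then show ?thesis
      using Cons.IH[of "grow l e ob"] Cons.prems True grow_nonempty[of ob l e] by simp
  next
    case False
    have "gball (mset (ob @ [e])) l (hd ob) \<subseteq> gball E l (hd ob)"
      using Cons.prems by (intro gball_mono) auto
    then have "grow l e ob = ob" using False by (auto simp: grow_def)
    then show ?thesis using Cons False by simp
  qed
qed simp

text \<open>Edges on shortest paths to the root are acceptable as soon as the rest of the path is known.\<close>

lemma exists_growing_edge:
  assumes sub: "mset ob \<subseteq># F" "mset ob \<noteq> F" and ne: "ob \<noteq> []"
    and F: "verts F \<subseteq> gball F l (hd ob)"
  shows "\<exists>e \<in># F - mset ob. ends e \<subseteq> gball (mset (ob @ [e])) l (hd ob)"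
proof (cases "\<forall>L\<le>l. \<forall>x. \<forall>y\<in>ends (hd ob). (x, y) \<in> adj F ^^ L \<longrightarrow> (x, y) \<in> adj (mset ob) ^^ L")
  case True
  \<comment> \<open>All short connections to the root are known already, so any missing edge is
    acceptable.\<close>
  then have "gball F l (hd ob) \<subseteq> gball (mset ob) l (hd ob)"
    by (fastforce simp: gball_def ball_of_def)
  moreover obtain e where e: "e \<in># F - mset ob"
    using sub by (metis Diff_eq_empty_iff_mset multiset_nonemptyE subset_mset.antisym)
  moreover have "ends e \<subseteq> verts F" using e in_diffD by (force simp: verts_def)
  moreover have "gball (mset ob) l (hd ob) \<subseteq> gball (mset (ob @ [e])) l (hd ob)"
    by (rule gball_mono) auto
  ultimately show ?thesis using F by blast
next
  case False
  \<comment> \<open>Otherwise take a shortest connection of \<open>F\<close> that is not yet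
    available. By minimality its tail from the second vertex \<open>z\<close> is available, so its
    first edge, between \<open>x\<close> and \<open>z\<close>, is missing and acceptable.\<close>
  define P where "P L \<longleftrightarrow> L \<le> l \<and> (\<exists>x. \<exists>y\<in>ends (hd ob). (x, y) \<in> adj F ^^ L \<and> (x, y) \<notin> adj (mset ob) ^^ L)"
    for L
  define L where "L = (LEAST L. P L)"
  have "\<exists>L. P L" using False by (auto simp: P_def)
  then have PL: "P L" unfolding L_def by (metis LeastI)
  have min: "\<not> P L'" if "L' < L" for L' using that unfolding L_def by (rule not_less_Least)
  obtain x y where xy: "L \<le> l" "y \<in> ends (hd ob)" "(x, y) \<in> adj F ^^ L" "(x, y) \<notin> adj (mset ob) ^^ L"
    using PL by (auto simp: P_def)
  obtain L' where L': "L = Suc L'" using xy by (cases L) auto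
  then obtain z where z: "(x, z) \<in> adj F" "(z, y) \<in> adj F ^^ L'" using xy by (metis relpow_Suc_D2)
  have z': "(z, y) \<in> adj (mset ob) ^^ L'" using min[of L'] z xy L' by (auto simp: P_def)
  obtain e where e: "e \<in># F" "e = (x, z) \<or> e = (z, x)" using z by (auto simp: adj_def)
  have "e \<notin># mset ob"
  proof
    assume "e \<in># mset ob"
    then have "(x, z) \<in> adj (mset ob)" using e by (auto simp: adj_def)
    then show False using relpow_Suc_I2[OF _ z'] xy L' by auto
  qed
  then have "e \<in># F - mset ob" using e by (simp add: in_diff_count not_in_iff[THEN iffD1])
  have sub': "adj (mset ob) \<subseteq> adj (mset (ob @ [e]))" by (rule adj_mono) auto
  have z2: "(z, y) \<in> adj (mset (ob @ [e])) ^^ L'" using relpow_mono_rel[OF sub'] z' by blast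
  have "(x, z) \<in> adj (mset (ob @ [e]))" using e by (auto simp: adj_def)
  then have "(x, y) \<in> adj (mset (ob @ [e])) ^^ L" unfolding L' using z2 by (rule relpow_Suc_I2)
  then have "x \<in> ball_of (mset (ob @ [e])) l y" using xy(1) unfolding ball_of_def by blast
  moreover have "z \<in> ball_of (mset (ob @ [e])) l y"
    using z2 xy(1) L' Suc_leD unfolding ball_of_def by blast
  moreover have "ends e = {x, z}" using e by (auto simp: ends_def)
  ultimately have "ends e \<subseteq> gball (mset (ob @ [e])) l (hd ob)"
    using xy(2) by (auto simp: gball_def simp del: mset_append)
  then show ?thesis using \<open>e \<in># F - mset ob\<close> by blast
qed

text \<open>Appending edges that are accepted at once exhausts \<open>F\<close>. The resulting order
  shows that the diagonal of the kernel is positive.\<close>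

lemma exists_complete_order:
  assumes "mset ob \<subseteq># F" and "ob \<noteq> []" and "verts F \<subseteq> gball F l (hd ob)"
  shows "\<exists>w. mset w = F - mset ob \<and> mset (fold (grow l) w ob) = F"
  using assms
proof (induction "size (F - mset ob)" arbitrary: ob)
  case 0
  then have "F - mset ob = {#}" by auto
  then have "mset ob = F" using 0 by (simp add: Diff_eq_empty_iff_mset subset_mset.antisym)
  then show ?case by (intro exI[of _ "[]"]) auto
next
  case (Suc N)
  then have "mset ob \<noteq> F" by auto
  then obtain e where e: "e \<in># F - mset ob" "ends e \<subseteq> gball (mset (ob @ [e])) l (hd ob)"
    using exists_growing_edge Suc.prems by blast
  have g: "grow l e ob = ob @ [e]" using e by (simp add: grow_def)
  have eq: "F - mset (ob @ [e]) = F - mset ob - {#e#}" by simp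
  have sub: "mset (ob @ [e]) \<subseteq># F"
    using e(1) Suc.prems(1) by (auto simp: subseteq_mset_def in_diff_count Suc_le_eq)
  have "\<exists>w. mset w = F - mset (ob @ [e]) \<and> mset (fold (grow l) w (ob @ [e])) = F"
  proof (rule Suc.hyps(1))
    show "N = size (F - mset (ob @ [e]))"
      unfolding eq using Suc.hyps(2) size_Diff_singleton[OF e(1)] by (simp only:)
  qed (use sub Suc.prems in auto)
  then obtain w where "mset w = F - mset (ob @ [e])" "mset (fold (grow l) w (ob @ [e])) = F" by blast
  then have "mset (e # w) = F - mset ob" and "mset (fold (grow l) (e # w) ob) = F"
    unfolding eq using e(1) g by (simp_all del: diff_diff_add_mset)
  then show ?case by blast
qed

section \<open>Exploration under renaming of vertices\<close>

lemma relpow_image_rel: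
  fixes R :: "'a rel" and f :: "'a \<Rightarrow> 'b"
  assumes "(x, y) \<in> R ^^ n"
  shows "(f x, f y) \<in> (map_prod f f ` R) ^^ n"
  using assms
proof (induction n arbitrary: y)
  case (Suc n)
  then obtain z where "(x, z) \<in> R ^^ n" "(z, y) \<in> R" by auto
  then show ?case using Suc.IH[of z] by (auto intro!: relcompI)
qed auto

lemma adj_image: "adj (image_mset (map_prod f f) E) = map_prod f f ` adj E"
  by (force simp: adj_def)

text \<open>Connections are pushed forward by \<open>f\<close> and pulled back by the inverse of
  \<open>f\<close> on \<open>W\<close>.\<close>

lemma gball_image_iff:
  assumes inj: "inj_on f W" and E: "verts E \<subseteq> W" and a: "ends a \<subseteq> W" and x: "x \<in> W"
  shows "f x \<in> gball (image_mset (map_prod f f) E) l (map_prod f f a) \<longleftrightarrow> x \<in> gball E l a"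
proof -
  let ?g = "inv_into W f"
  have adjW: "adj E \<subseteq> W \<times> W" using E by (auto dest!: adj_verts)
  have gf: "map_prod ?g ?g ` map_prod f f ` adj E = adj E"
  proof -
    have "map_prod ?g ?g (map_prod f f p) = p" if "p \<in> adj E" for p
      using that adjW inj by (cases p) (auto simp: inv_into_f_f)
    then show ?thesis by (force simp: image_image)
  qed
  have conn: "(f x, f y) \<in> (map_prod f f ` adj E) ^^ L \<longleftrightarrow> (x, y) \<in> adj E ^^ L" if "y \<in> W" for y L
    using relpow_image_rel[of x y L "adj E" f]
      relpow_image_rel[of "f x" "f y" L "map_prod f f ` adj E" ?g] inj x that
    by (auto simp: gf inv_into_f_f)
  show ?thesis
    using conn a by (auto simp: gball_def ball_of_def adj_image ends_def)
qed

lemma ends_map_prod: "ends (map_prod f f e) = f ` ends e"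
  by (cases e) (auto simp: ends_def)

lemma verts_image: "verts (image_mset (map_prod f f) E) = f ` verts E"
  by (auto simp: verts_def ends_map_prod)

lemma fold_grow_map:
  assumes inj: "inj_on f W" and "ob \<noteq> []" and "verts (mset ob) \<subseteq> W" and "verts (mset w) \<subseteq> W"
  shows "fold (grow l) (map (map_prod f f) w) (map (map_prod f f) ob) =
     map (map_prod f f) (fold (grow l) w ob)"
  using assms(2-)
proof (induction w arbitrary: ob)
  case (Cons e w)
  let ?F = "map_prod f f"
  have hd: "ends (hd ob) \<subseteq> W" using Cons.prems by (cases ob) (auto simp: verts_def)
  have e: "ends e \<subseteq> W" "verts (mset (ob @ [e])) \<subseteq> W" using Cons.prems by (auto simp: verts_def)
  have "ends (?F e) \<subseteq> gball (mset (map ?F ob @ [?F e])) l (hd (map ?F ob)) \<longleftrightarrow>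
      ends e \<subseteq> gball (mset (ob @ [e])) l (hd ob)"
    using gball_image_iff[OF inj e(2) hd, of _ l] Cons.prems(1) e(1)
    by (auto simp: ends_map_prod hd_map)
  then have "grow l (?F e) (map ?F ob) = map ?F (grow l e ob)" by (simp add: grow_def)
  moreover have "verts (mset (grow l e ob)) \<subseteq> W" using e Cons.prems by (auto simp: grow_def)
  moreover have "verts (mset w) \<subseteq> W" using Cons.prems by (auto simp: verts_def)
  ultimately show ?case using Cons.IH[of "grow l e ob"] Cons.prems grow_nonempty[of ob l e] by simp
qed simp

section \<open>Rooted types\<close>

definition rooted_nbhds :: "nat \<Rightarrow> nat \<Rightarrow> nat \<Rightarrow> rooted set" where
  "rooted_nbhds k l D = {(H, \<psi>, e). (H, \<psi>, e) \<in> doubly_rooted k \<and> degree_bounded D H \<and>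
     (\<forall>w\<in>fst H. w \<in> edge_ball H l e)}"

lemma types_eq: "types k l D = type_of k ` rooted_nbhds k l D"
  unfolding types_def rooted_nbhds_def by (auto simp: image_def) blast+

lemma doubly_rooted_iff:
  "((W, F), \<psi>, e) \<in> doubly_rooted k \<longleftrightarrow> finite W \<and> verts F \<subseteq> W \<and> (\<forall>(u, v)\<in>#F. u \<noteq> v) \<and>
     \<psi> \<in> W \<rightarrow>\<^sub>E {1..k} \<and> (\<forall>(u, v)\<in>#F. \<psi> u \<noteq> \<psi> v) \<and> e \<in># F"
  by (auto simp: doubly_rooted_def is_graph_def proper_coloring_def verts_def ends_def)

lemma ends_subset_verts: "e \<in># F \<Longrightarrow> ends e \<subseteq> verts F"
  by (auto simp: verts_def)

lemma edge_in_verts: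
  assumes "(u, v) \<in># F" shows "u \<in> verts F" and "v \<in> verts F"
  using ends_subset_verts[OF assms] by (simp_all add: ends_def)

text \<open>The ball around an edge of \<open>F\<close> consists of endpoints of edges, so there are
  no isolated vertices and \<open>F\<close> determines \<open>W\<close>. This is why collecting all
  edges recovers the whole triple.\<close>

lemma rooted_nbhds_iff:
  "((W, F), \<psi>, e) \<in> rooted_nbhds k l D \<longleftrightarrow>
     ((W, F), \<psi>, e) \<in> doubly_rooted k \<and> deg_le D F \<and> W = verts F \<and> verts F \<subseteq> gball F l e"
proof -
  have "edge_ball (W, F) l e = gball F l e \<and> (degree_bounded D (W, F) \<longleftrightarrow> deg_le D F) \<and>
      gball F l e \<subseteq> verts F \<and> verts F \<subseteq> W" if "((W, F), \<psi>, e) \<in> doubly_rooted k"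
    using that gball_subset[of F l e] ends_subset_verts[of e F]
      edge_ball_eq_gball[of F W e l] degree_bounded_iff_deg_le[of F W D]
    by (auto simp: doubly_rooted_iff)
  then show ?thesis by (auto simp: rooted_nbhds_def)
qed

lemma count_image_map_prod:
  assumes "inj_on f W" and "verts F \<subseteq> W" and "u \<in> W" and "v \<in> W"
  shows "count (image_mset (map_prod f f) F) (f u, f v) = count F (u, v)"
proof -
  have "f a = f u \<and> f b = f v \<longleftrightarrow> a = u \<and> b = v" if "(a, b) \<in># F" for a b
    using edge_in_verts[OF that] assms inj_on_eq_iff[OF assms(1)] by blast
  then have "map_prod f f -` {(f u, f v)} \<inter> set_mset F = {(u, v)} \<inter> set_mset F"
    by auto
  then show ?thesis
    by (cases "(u, v) \<in># F") (auto simp: count_image_mset count_eq_zero_iff)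
qed

text \<open>Isomorphism says nothing about the case \<open>u = v\<close>, but there are no loops and
  all edges lie inside the vertex sets, so agreement off the diagonal is equality of
  multisets.\<close>

lemma rooted_iso_iff:
  assumes R: "((W, F), \<psi>, e) \<in> doubly_rooted k" and R': "((W', F'), \<psi>', e') \<in> doubly_rooted k"
  shows "rooted_iso ((W, F), \<psi>, e) ((W', F'), \<psi>', e') \<longleftrightarrow>
    (\<exists>f. bij_betw f W W' \<and> F' = image_mset (map_prod f f) F \<and> (\<forall>w\<in>W. \<psi> w = \<psi>' (f w)) \<and>
       e' = map_prod f f e)"
proof -
  have eq: "(\<forall>u\<in>W. \<forall>v\<in>W. u \<noteq> v \<longrightarrow> count F (u, v) = count F' (f u, f v)) \<longleftrightarrow>
      F' = image_mset (map_prod f f) F" if bij: "bij_betw f W W'" for f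
  proof
    have inj: "inj_on f W" and im: "f ` W = W'" using bij by (auto simp: bij_betw_def)
    have F: "verts F \<subseteq> W" "verts F' \<subseteq> W'" using R R' by (auto simp: doubly_rooted_iff)
    have diag: "count F (u, u) = 0" "count F' (u, u) = 0" for u
      using R R' by (auto simp: doubly_rooted_iff not_in_iff[symmetric])
    assume h: "\<forall>u\<in>W. \<forall>v\<in>W. u \<noteq> v \<longrightarrow> count F (u, v) = count F' (f u, f v)"
    show "F' = image_mset (map_prod f f) F"
    proof (rule multiset_eqI)
      fix p :: edge obtain x y where p: "p = (x, y)" by force
      show "count F' p = count (image_mset (map_prod f f) F) p"
      proof (cases "x \<in> W' \<and> y \<in> W'")
        case True
        then obtain u v where uv: "u \<in> W" "v \<in> W" "x = f u" "y = f v" using im by blast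
        then show ?thesis
          using h count_image_map_prod[OF inj F(1), of u v] diag by (cases "u = v") (auto simp: p)
      next
        case False
        have "p \<notin># F'" using False F(2) by (auto simp: p verts_def ends_def)
        moreover have "p \<notin># image_mset (map_prod f f) F"
        proof
          assume "p \<in># image_mset (map_prod f f) F"
          then have "ends p \<subseteq> verts (image_mset (map_prod f f) F)" by (rule ends_subset_verts)
          then show False using False F(1) im by (auto simp: verts_image p ends_def)
        qed
        ultimately show ?thesis by (metis not_in_iff)
      qed
    qed
  next
    assume "F' = image_mset (map_prod f f) F"
    moreover have "inj_on f W" "verts F \<subseteq> W"
      using bij R by (auto simp: bij_betw_def doubly_rooted_iff)
    ultimately show "\<forall>u\<in>W. \<forall>v\<in>W. u \<noteq> v \<longrightarrow> count F (u, v) = count F' (f u, f v)"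
      by (simp add: count_image_map_prod)
  qed
  show ?thesis unfolding rooted_iso_def prod.case by (intro ex_cong1) (use eq in blast)
qed

lemma rooted_iso_sym:
  assumes "R \<in> doubly_rooted k" and "R' \<in> doubly_rooted k" and "rooted_iso R R'"
  shows "rooted_iso R' R"
proof -
  obtain W F \<psi> e where R: "R = ((W, F), \<psi>, e)" by (metis prod.collapse)
  obtain W' F' \<psi>' e' where R': "R' = ((W', F'), \<psi>', e')" by (metis prod.collapse)
  have d: "((W, F), \<psi>, e) \<in> doubly_rooted k" "((W', F'), \<psi>', e') \<in> doubly_rooted k"
    using assms R R' by auto
  obtain f where bij: "bij_betw f W W'" and F': "F' = image_mset (map_prod f f) F"
    and \<psi>: "\<forall>w\<in>W. \<psi> w = \<psi>' (f w)" and e': "e' = map_prod f f e"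
    using assms(3) rooted_iso_iff[OF d] unfolding R R' by blast
  let ?g = "inv_into W f"
  have gf: "?g (f x) = x" if "x \<in> W" for x using bij that by (simp add: bij_betw_inv_into_left)
  have gf2: "map_prod ?g ?g (map_prod f f p) = p" if "p \<in># F" for p
  proof -
    have "fst p \<in> W" "snd p \<in> W" using d(1) that by (auto simp: doubly_rooted_iff verts_def ends_def)
    then show ?thesis by (cases p) (simp add: gf)
  qed
  have "image_mset (map_prod ?g ?g) F' = image_mset (\<lambda>p. p) F"
    unfolding F' multiset.map_comp by (rule image_mset_cong) (simp add: gf2)
  then have "F = image_mset (map_prod ?g ?g) F'" by simp
  moreover have "bij_betw ?g W' W" using bij by (rule bij_betw_inv_into)
  moreover have "\<forall>w\<in>W'. \<psi>' w = \<psi> (?g w)"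
    using \<psi> bij by (metis bij_betw_def bij_betw_inv_into_right inv_into_into)
  moreover have "e = map_prod ?g ?g e'" using d(1) gf2 by (simp add: e' doubly_rooted_iff)
  ultimately show ?thesis unfolding R R' rooted_iso_iff[OF d(2) d(1)] by blast
qed

lemma rooted_iso_trans:
  assumes "R \<in> doubly_rooted k" and "R' \<in> doubly_rooted k" and "R'' \<in> doubly_rooted k"
    and "rooted_iso R R'" and "rooted_iso R' R''"
  shows "rooted_iso R R''"
proof -
  obtain W F \<psi> e where R: "R = ((W, F), \<psi>, e)" by (metis prod.collapse)
  obtain W' F' \<psi>' e' where R': "R' = ((W', F'), \<psi>', e')" by (metis prod.collapse)
  obtain W'' F'' \<psi>'' e'' where R'': "R'' = ((W'', F''), \<psi>'', e'')" by (metis prod.collapse)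
  have d: "((W, F), \<psi>, e) \<in> doubly_rooted k" "((W', F'), \<psi>', e') \<in> doubly_rooted k"
     "((W'', F''), \<psi>'', e'') \<in> doubly_rooted k"
    using assms R R' R'' by auto
  obtain f where f: "bij_betw f W W'" "F' = image_mset (map_prod f f) F"
    "\<forall>w\<in>W. \<psi> w = \<psi>' (f w)" "e' = map_prod f f e"
    using assms(4) rooted_iso_iff[OF d(1,2)] unfolding R R' by blast
  obtain g where g: "bij_betw g W' W''" "F'' = image_mset (map_prod g g) F'"
    "\<forall>w\<in>W'. \<psi>' w = \<psi>'' (g w)" "e'' = map_prod g g e'"
    using assms(5) rooted_iso_iff[OF d(2,3)] unfolding R' R'' by blast
  have "bij_betw (g \<circ> f) W W''" using f(1) g(1) by (rule bij_betw_trans)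
  moreover have "F'' = image_mset (map_prod (g \<circ> f) (g \<circ> f)) F"
    by (simp add: g f multiset.map_comp map_prod_compose)
  moreover have "\<forall>w\<in>W. \<psi> w = \<psi>'' ((g \<circ> f) w)" using f g by (auto simp: bij_betw_def)
  moreover have "e'' = map_prod (g \<circ> f) (g \<circ> f) e" by (cases e) (simp add: f g)
  ultimately show ?thesis unfolding R R'' rooted_iso_iff[OF d(1,3)] by blast
qed

lemma rooted_iso_refl: "rooted_iso R R"
  by (cases R) (auto simp: rooted_iso_def intro!: exI[of _ id])

lemma type_of_eqI:
  assumes "R \<in> doubly_rooted k" and "R' \<in> doubly_rooted k" and "rooted_iso R R'"
  shows "type_of k R = type_of k R'"
proof -
  have "rooted_iso R S \<longleftrightarrow> rooted_iso R' S" if "S \<in> doubly_rooted k" for S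
    using rooted_iso_trans[OF assms(1,2) that assms(3)]
      rooted_iso_trans[OF assms(2,1) that rooted_iso_sym[OF assms]] by blast
  then show ?thesis by (auto simp: type_of_def)
qed

lemma type_of_eqD:
  assumes "R \<in> doubly_rooted k" and "type_of k R = type_of k R'"
  shows "rooted_iso R' R"
  using assms rooted_iso_refl[of R] by (auto simp: type_of_def)

section \<open>The kernel from true to observed types\<close>

definition obs_rooted :: "(nat \<Rightarrow> nat) \<Rightarrow> edge list \<Rightarrow> rooted" where
  "obs_rooted \<kappa> ob = ((verts (mset ob), mset ob), restrict \<kappa> (verts (mset ob)), hd ob)"

definition obs_type :: "nat \<Rightarrow> nat \<Rightarrow> (nat \<Rightarrow> nat) \<Rightarrow> edge \<Rightarrow> edge list \<Rightarrow> rooted_type" where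
  "obs_type k l \<kappa> a w = type_of k (obs_rooted \<kappa> (explore l a w))"

text \<open>The root is left out of the random order because it has arrived before its exploration
  starts.\<close>

fun obs_kernel :: "nat \<Rightarrow> nat \<Rightarrow> rooted \<Rightarrow> rooted_type pmf" where
  "obs_kernel k l ((W, F), \<psi>, e) =
     map_pmf (obs_type k l \<psi> e) (pmf_of_set (permutations_of_multiset (F - {#e#})))"

lemma obs_rooted_doubly_rooted:
  assumes "((W, F), \<psi>, e) \<in> doubly_rooted k" and "mset ob \<subseteq># F" and "ob \<noteq> []"
  shows "obs_rooted \<psi> ob \<in> doubly_rooted k"
proof -
  have sub: "set ob \<subseteq> set_mset F" using set_mset_mono[OF assms(2)] by simp
  then have v: "verts (mset ob) \<subseteq> verts F" by (intro verts_mono) simp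
  have v': "verts F \<subseteq> W" using assms(1) by (simp add: doubly_rooted_iff)
  have ne: "\<psi> u \<noteq> \<psi> v" "u \<noteq> v" if "(u, v) \<in> set ob" for u v
    using assms(1) subsetD[OF sub that] by (auto simp: doubly_rooted_iff)
  have "restrict \<psi> (verts (mset ob)) u \<noteq> restrict \<psi> (verts (mset ob)) v"
    if "(u, v) \<in> set ob" for u v
    using edge_in_verts[of u v "mset ob"] that ne[OF that] by simp
  then have "\<forall>(u, v)\<in>#mset ob. restrict \<psi> (verts (mset ob)) u \<noteq> restrict \<psi> (verts (mset ob)) v"
    by (auto simp del: restrict_apply)
  moreover have "\<forall>(u, v)\<in>#mset ob. u \<noteq> v" using ne(2) by auto
  moreover have "restrict \<psi> (verts (mset ob)) \<in> verts (mset ob) \<rightarrow>\<^sub>E {1..k}"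
    using assms(1) v v' by (auto simp: doubly_rooted_iff PiE_iff)
  ultimately show ?thesis using assms(3) unfolding obs_rooted_def doubly_rooted_iff by simp
qed

lemma mset_explore_subset:
  assumes "w \<in> permutations_of_multiset (F - {#e#})" and "e \<in># F"
  shows "mset (explore l e w) \<subseteq># F"
  using mset_explore[of l w e] assms by (simp add: permutations_of_multiset_def)

lemma obs_rooted_nbhd:
  assumes R: "((W, F), \<psi>, e) \<in> rooted_nbhds k l D"
    and w: "w \<in> permutations_of_multiset (F - {#e#})"
  shows "obs_rooted \<psi> (explore l e w) \<in> rooted_nbhds k l D"
proof -
  have "e \<in># F" and d: "((W, F), \<psi>, e) \<in> doubly_rooted k" and "deg_le D F"
    using R by (auto simp: rooted_nbhds_iff doubly_rooted_iff)
  then have sub: "mset (explore l e w) \<subseteq># F" using w by (intro mset_explore_subset)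
  have "obs_rooted \<psi> (explore l e w) \<in> doubly_rooted k"
    using obs_rooted_doubly_rooted[OF d sub] by simp
  then show ?thesis
    using deg_le_mono[OF \<open>deg_le D F\<close> sub] verts_explore[of l w e]
    by (simp add: obs_rooted_def rooted_nbhds_iff)
qed

text \<open>An isomorphism carries the uniform order to the uniform order and commutes with
  exploration, so corresponding orders give isomorphic observations.\<close>

lemma obs_kernel_iso:
  assumes R: "R \<in> doubly_rooted k" and R': "R' \<in> doubly_rooted k" and iso: "rooted_iso R R'"
  shows "obs_kernel k l R = obs_kernel k l R'"
proof -
  obtain W F \<psi> e where R_eq: "R = ((W, F), \<psi>, e)" by (metis prod.collapse)
  obtain W' F' \<psi>' e' where R'_eq: "R' = ((W', F'), \<psi>', e')" by (metis prod.collapse)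
  have d: "((W, F), \<psi>, e) \<in> doubly_rooted k" "((W', F'), \<psi>', e') \<in> doubly_rooted k"
    using R R' R_eq R'_eq by auto
  obtain f where bij: "bij_betw f W W'" and F': "F' = image_mset (map_prod f f) F"
    and \<psi>: "\<forall>w\<in>W. \<psi> w = \<psi>' (f w)" and e': "e' = map_prod f f e"
    using iso rooted_iso_iff[OF d] unfolding R_eq R'_eq by blast
  let ?f = "map_prod f f"
  have eF: "e \<in># F" and FW: "verts F \<subseteq> W" using d(1) by (auto simp: doubly_rooted_iff)
  have inj: "inj_on f W" using bij by (simp add: bij_betw_def)
  have injF: "inj_on ?f (set_mset F)"
  proof (rule inj_on_subset)
    show "inj_on ?f (W \<times> W)" using inj by (intro map_prod_inj_on)
    show "set_mset F \<subseteq> W \<times> W" using FW by (force simp: verts_def ends_def)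
  qed
  have "F' - {#e'#} = image_mset ?f (F - {#e#})"
    unfolding F' e' using eF by (simp add: image_mset_Diff)
  then have perm: "permutations_of_multiset (F' - {#e'#}) =
      map ?f ` permutations_of_multiset (F - {#e#})"
    by (simp add: permutations_of_multiset_image)
  have "inj_on (map ?f) (permutations_of_multiset (F - {#e#}))"
  proof (rule inj_on_mapI, rule inj_on_subset[OF injF])
    show "\<Union> (set ` permutations_of_multiset (F - {#e#})) \<subseteq> set_mset F"
      using permutations_of_multiset_lists[of "F - {#e#}"] by (auto dest!: in_diffD)
  qed
  then have pmf_eq: "pmf_of_set (permutations_of_multiset (F' - {#e'#})) =
      map_pmf (map ?f) (pmf_of_set (permutations_of_multiset (F - {#e#})))"
    unfolding perm by (subst map_pmf_of_set_inj) auto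
  have "obs_type k l \<psi>' e' (map ?f w) = obs_type k l \<psi> e w"
    if w: "w \<in> permutations_of_multiset (F - {#e#})" for w
  proof -
    have "set w \<subseteq> set_mset F"
      using w permutations_of_multiset_lists[of "F - {#e#}"] by (auto dest!: in_diffD)
    then have "verts (mset w) \<subseteq> verts F" by (intro verts_mono) simp
    moreover have "verts (mset [e]) \<subseteq> verts F" using eF by (intro verts_mono) simp
    ultimately have ex: "explore l e' (map ?f w) = map ?f (explore l e w)"
      using fold_grow_map[OF inj, of "[e]" w l] FW by (auto simp: e')
    let ?ob = "explore l e w"
    have sub: "mset ?ob \<subseteq># F" using w eF by (rule mset_explore_subset)
    have sub': "mset (map ?f ?ob) \<subseteq># F'"
      using image_mset_subseteq_mono[OF sub, of ?f] by (simp add: F')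
    have obW: "verts (mset ?ob) \<subseteq> W"
      using verts_mono[OF set_mset_mono[OF sub]] FW by blast
    have o: "obs_rooted \<psi> ?ob \<in> doubly_rooted k" "obs_rooted \<psi>' (map ?f ?ob) \<in> doubly_rooted k"
      using obs_rooted_doubly_rooted[OF d(1) sub] obs_rooted_doubly_rooted[OF d(2) sub'] by auto
    have "rooted_iso (obs_rooted \<psi> ?ob) (obs_rooted \<psi>' (map ?f ?ob))"
      using o unfolding obs_rooted_def
    proof (subst rooted_iso_iff)
      have "bij_betw f (verts (mset ?ob)) (f ` verts (mset ?ob))"
        using inj_on_subset[OF inj obW] by (rule inj_on_imp_bij_betw)
      then show "\<exists>g. bij_betw g (verts (mset ?ob)) (verts (mset (map ?f ?ob))) \<and>
         mset (map ?f ?ob) = image_mset (map_prod g g) (mset ?ob) \<and>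
         (\<forall>w\<in>verts (mset ?ob). restrict \<psi> (verts (mset ?ob)) w =
            restrict \<psi>' (verts (mset (map ?f ?ob))) (g w)) \<and>
         hd (map ?f ?ob) = map_prod g g (hd ?ob)"
        using obW \<psi> by (intro exI[of _ f]) (auto simp: verts_image hd_map)
    qed auto
    then show ?thesis
      unfolding obs_type_def ex by (intro type_of_eqI[symmetric] o)
  qed
  then show ?thesis
    unfolding R_eq R'_eq by (auto simp: pmf_eq map_pmf_comp intro!: map_pmf_cong)
qed

text \<open>The choice does no harm: the observation law and the number of edges, which are all that
  is read off, are invariant under isomorphism.\<close>

definition rep_of :: "nat \<Rightarrow> nat \<Rightarrow> nat \<Rightarrow> rooted_type \<Rightarrow> rooted" where
  "rep_of k l D \<tau> = (SOME R. R \<in> rooted_nbhds k l D \<and> type_of k R = \<tau>)"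

definition type_kernel :: "nat \<Rightarrow> nat \<Rightarrow> nat \<Rightarrow> rooted_type \<Rightarrow> rooted_type pmf" where
  "type_kernel k l D \<tau> = obs_kernel k l (rep_of k l D \<tau>)"

definition type_rank :: "nat \<Rightarrow> nat \<Rightarrow> nat \<Rightarrow> rooted_type \<Rightarrow> nat" where
  "type_rank k l D \<tau> = size (snd (fst (rep_of k l D \<tau>)))"

lemma rooted_nbhds_doubly_rooted: "R \<in> rooted_nbhds k l D \<Longrightarrow> R \<in> doubly_rooted k"
  by (auto simp: rooted_nbhds_def)

lemma rep_of_type:
  assumes "R \<in> rooted_nbhds k l D"
  shows "rep_of k l D (type_of k R) \<in> rooted_nbhds k l D" and
    "rooted_iso R (rep_of k l D (type_of k R))"
proof -
  have *: "rep_of k l D (type_of k R) \<in> rooted_nbhds k l D \<and>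
      type_of k (rep_of k l D (type_of k R)) = type_of k R"
    using someI[where P = "\<lambda>S. S \<in> rooted_nbhds k l D \<and> type_of k S = type_of k R" and x = R] assms
    by (simp add: rep_of_def)
  then show "rep_of k l D (type_of k R) \<in> rooted_nbhds k l D" by simp
  show "rooted_iso R (rep_of k l D (type_of k R))"
    using * by (intro type_of_eqD) (auto dest: rooted_nbhds_doubly_rooted)
qed

lemma type_kernel_type_of:
  assumes "R \<in> rooted_nbhds k l D"
  shows "type_kernel k l D (type_of k R) = obs_kernel k l R"
  unfolding type_kernel_def
  by (intro obs_kernel_iso[symmetric] rooted_nbhds_doubly_rooted[OF assms]
      rooted_nbhds_doubly_rooted[OF rep_of_type(1)[OF assms]] rep_of_type(2)[OF assms])

lemma type_rank_type_of:
  assumes "((W, F), \<psi>, e) \<in> rooted_nbhds k l D"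
  shows "type_rank k l D (type_of k ((W, F), \<psi>, e)) = size F"
proof -
  obtain W' F' \<psi>' e' where R': "rep_of k l D (type_of k ((W, F), \<psi>, e)) = ((W', F'), \<psi>', e')"
    by (metis prod.collapse)
  have "\<exists>f. F' = image_mset (map_prod f f) F"
    using rep_of_type[OF assms] assms rooted_iso_iff[of W F \<psi> e k W' F' \<psi>' e']
    unfolding R' by (auto dest!: rooted_nbhds_doubly_rooted)
  then show ?thesis unfolding type_rank_def R' by auto
qed

lemma type_kernel_triangular:
  assumes "\<tau> \<in> types k l D" and "\<sigma> \<in> set_pmf (type_kernel k l D \<tau>)"
  shows "\<sigma> = \<tau> \<or> type_rank k l D \<sigma> < type_rank k l D \<tau>"
proof -
  obtain W F \<psi> e where R: "((W, F), \<psi>, e) \<in> rooted_nbhds k l D"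
    and \<tau>: "\<tau> = type_of k ((W, F), \<psi>, e)"
    using assms(1) by (force simp: types_eq)
  have eF: "e \<in># F" and WF: "W = verts F" and \<psi>: "\<psi> \<in> W \<rightarrow>\<^sub>E {1..k}"
    using R by (auto simp: rooted_nbhds_iff doubly_rooted_iff)
  obtain w where w: "w \<in> permutations_of_multiset (F - {#e#})" and \<sigma>: "\<sigma> = obs_type k l \<psi> e w"
    using assms(2) unfolding \<tau> type_kernel_type_of[OF R] by auto
  let ?ob = "explore l e w"
  have N: "obs_rooted \<psi> ?ob \<in> rooted_nbhds k l D" using R w by (rule obs_rooted_nbhd)
  have rank: "type_rank k l D \<sigma> = size (mset ?ob)"
    using type_rank_type_of N unfolding \<sigma> obs_type_def obs_rooted_def by blast
  have sub: "mset ?ob \<subseteq># F" using w eF by (rule mset_explore_subset)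
  show "\<sigma> = \<tau> \<or> type_rank k l D \<sigma> < type_rank k l D \<tau>"
  proof (cases "mset ?ob = F")
    case True
    \<comment> \<open>Without isolated vertices and with an extensional coloring, equal edges mean
      the very same triple.\<close>
    then have "obs_rooted \<psi> ?ob = ((W, F), \<psi>, e)"
      using \<psi> by (auto simp: obs_rooted_def WF PiE_restrict)
    then show ?thesis unfolding \<sigma> \<tau> obs_type_def by simp
  next
    case False
    then have "size (mset ?ob) < size F" using sub by (intro mset_subset_size) auto
    then show ?thesis unfolding rank \<tau> type_rank_type_of[OF R] by simp
  qed
qed

lemma type_kernel_diagonal:
  assumes "\<tau> \<in> types k l D"
  shows "pmf (type_kernel k l D \<tau>) \<tau> > 0"
proof -
  obtain W F \<psi> e where R: "((W, F), \<psi>, e) \<in> rooted_nbhds k l D"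
    and \<tau>: "\<tau> = type_of k ((W, F), \<psi>, e)"
    using assms(1) by (force simp: types_eq)
  have eF: "e \<in># F" and WF: "W = verts F" "verts F \<subseteq> gball F l e" and \<psi>: "\<psi> \<in> W \<rightarrow>\<^sub>E {1..k}"
    using R by (auto simp: rooted_nbhds_iff doubly_rooted_iff)
  obtain w where w: "mset w = F - {#e#}" "mset (explore l e w) = F"
    using exists_complete_order[of "[e]" F l] eF WF by auto
  have "obs_rooted \<psi> (explore l e w) = ((W, F), \<psi>, e)"
    using \<psi> by (auto simp: obs_rooted_def WF PiE_restrict w)
  then have "obs_type k l \<psi> e w = \<tau>" by (simp add: obs_type_def \<tau>)
  then have "\<tau> \<in> set_pmf (type_kernel k l D \<tau>)"
    unfolding \<tau> type_kernel_type_of[OF R] using w by (auto intro!: permutations_of_multisetI image_eqI)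
  then show ?thesis by (simp add: pmf_positive)
qed

text \<open>Vertices can be renamed to \<open>{..<c}\<close> with \<open>c \<le> K\<close>, and the
  degree bound allows at most \<open>D * K\<close> edges, so finitely many triples represent all
  types.\<close>

lemma finite_types: "finite (types k l D)"
proof -
  define K where "K = ball_bound l D"
  \<comment> \<open>Edge multisets appear as images of bounded lists, which makes finiteness
    immediate.\<close>
  define Fin :: "rooted set" where "Fin = (Pow {..<K} \<times>
      (mset ` {xs. set xs \<subseteq> {..<K} \<times> {..<K} \<and> length xs \<le> D * K})) \<times>
      (\<Union>W\<in>Pow {..<K}. W \<rightarrow>\<^sub>E {1..k}) \<times> ({..<K} \<times> {..<K})"
  have "finite Fin" unfolding Fin_def
    by (intro finite_cartesian_product finite_imageI finite_lists_length_le finite_UN_I finite_PiE)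
       (auto intro: finite_subset)
  moreover have "types k l D \<subseteq> type_of k ` Fin"
  proof
    fix \<tau> assume "\<tau> \<in> types k l D"
    then obtain W F \<psi> e where R: "((W, F), \<psi>, e) \<in> rooted_nbhds k l D"
      and \<tau>: "\<tau> = type_of k ((W, F), \<psi>, e)"
      by (force simp: types_eq)
    have d: "((W, F), \<psi>, e) \<in> doubly_rooted k" and W: "W = verts F" "W \<subseteq> gball F l e" and deg: "deg_le D F"
      using R by (auto simp: rooted_nbhds_iff)
    have eF: "e \<in># F" and \<psi>: "\<psi> \<in> W \<rightarrow>\<^sub>E {1..k}" using d by (auto simp: doubly_rooted_iff)
    define c where "c = card W"
    have "c \<le> card (gball F l e)" unfolding c_def using W by (intro card_mono) auto
    then have cK: "c \<le> K" using card_gball_le[OF deg, of l e] by (simp add: K_def)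
    obtain f where bij: "bij_betw f W {..<c}"
      using ex_bij_betw_finite_nat[of W] W unfolding c_def lessThan_atLeast0 by auto
    let ?g = "inv_into W f"
    define F' where "F' = image_mset (map_prod f f) F"
    define \<psi>' where "\<psi>' = restrict (\<psi> \<circ> ?g) {..<c}"
    have fW: "f ` W = {..<c}" and inj: "inj_on f W" using bij by (auto simp: bij_betw_def)
    have g: "?g (f x) = x" if "x \<in> W" for x using that inj by simp
    have vF': "verts F' = {..<c}" by (simp add: F'_def verts_image W(1)[symmetric] fW)
    have edges: "u \<in> W \<and> v \<in> W \<and> u \<noteq> v \<and> \<psi> u \<noteq> \<psi> v" if "(u, v) \<in># F" for u v
      using d that by (fastforce simp: doubly_rooted_iff verts_def ends_def)
    have \<psi>'f: "\<psi>' (f x) = \<psi> x" if "x \<in> W" for x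
      using that fW g by (auto simp: \<psi>'_def)
    have ne: "f u \<noteq> f v" if "(u, v) \<in># F" for u v
      using edges[OF that] inj by (auto dest: inj_onD)
    have ne': "\<psi>' (f u) \<noteq> \<psi>' (f v)" if "(u, v) \<in># F" for u v
      using edges[OF that] by (simp add: \<psi>'f)
    have \<psi>'E: "\<psi>' \<in> {..<c} \<rightarrow>\<^sub>E {1..k}"
      unfolding \<psi>'_def using \<psi> bij_betw_inv_into[OF bij]
      by (auto simp: bij_betw_def Pi_iff PiE_iff)
    have d': "(({..<c}, F'), \<psi>', map_prod f f e) \<in> doubly_rooted k"
      unfolding doubly_rooted_iff using eF vF' \<psi>'E ne ne' by (auto simp: F'_def) metis+
    have "rooted_iso ((W, F), \<psi>, e) (({..<c}, F'), \<psi>', map_prod f f e)"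
      unfolding rooted_iso_iff[OF d d'] using bij \<psi>'f by (intro exI[of _ f]) (auto simp: F'_def)
    then have eq: "\<tau> = type_of k (({..<c}, F'), \<psi>', map_prod f f e)"
      unfolding \<tau> by (intro type_of_eqI d d')
    obtain xs where xs: "F' = mset xs" by (metis ex_mset)
    have eF': "map_prod f f e \<in># F'" using eF by (simp add: F'_def)
    have E': "set_mset F' \<subseteq> {..<K} \<times> {..<K}"
    proof
      fix p assume "p \<in># F'"
      then show "p \<in> {..<K} \<times> {..<K}"
        using edge_in_verts[of "fst p" "snd p" F'] vF' cK by (cases p) auto
    qed
    have "size F \<le> D * c" unfolding c_def by (rule size_edges_le[OF deg]) (auto simp: W)
    then have "length xs \<le> D * K"
      using cK xs by (metis F'_def le_trans mult_le_mono2 size_image_mset size_mset)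
    then have "(({..<c}, F'), \<psi>', map_prod f f e) \<in> Fin"
      unfolding Fin_def using xs E' cK \<psi>'E eF' by (auto intro!: bexI[of _ "{..<c}"])
    then show "\<tau> \<in> type_of k ` Fin" using eq by blast
  qed
  ultimately show ?thesis by (meson finite_imageI finite_subset)
qed

section \<open>Neighborhoods in the input graph\<close>

lemma measure_pmf_of_multiset:
  assumes "E \<noteq> {#}"
  shows "measure_pmf.prob (pmf_of_multiset E) S = size {#x \<in># E. x \<in> S#} / size E"
proof -
  let ?F = "{#x \<in># E. x \<in> S#}"
  have "set_mset ?F = S \<inter> set_pmf (pmf_of_multiset E)" using assms by auto
  then have "measure_pmf.prob (pmf_of_multiset E) S = measure_pmf.prob (pmf_of_multiset E) (set_mset ?F)"
    by (simp only: measure_Int_set_pmf)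
  also have "\<dots> = (\<Sum>x\<in>set_mset ?F. count ?F x / size E)"
    using assms by (simp add: measure_measure_pmf_finite)
  also have "\<dots> = size ?F / size E"
    by (simp only: size_multiset_overloaded_eq sum_divide_distrib[symmetric] of_nat_sum)
  finally show ?thesis .
qed

text \<open>Plays the role of \<open>cl\<close> in \<open>random_order_ge_independent\<close>; as a
  set of pairs it treats parallel edges alike.\<close>

definition edges_near :: "edge multiset \<Rightarrow> nat \<Rightarrow> edge \<Rightarrow> edge set" where
  "edges_near E l a = {e. ends e \<subseteq> gball E l a}"

locale colored_graph =
  fixes k l D n :: nat and E :: "edge multiset" and \<kappa> :: "nat \<Rightarrow> nat"
  assumes graph: "is_graph ({1..n}, E)"
    and degree: "degree_bounded D ({1..n}, E)"
    and coloring: "proper_coloring k ({1..n}, E) \<kappa>"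
begin

lemma verts_subset: "verts E \<subseteq> {1..n}"
  using graph by (fastforce simp: is_graph_def verts_def ends_def)

lemma deg_le: "deg_le D E"
  using degree degree_bounded_iff_deg_le[OF verts_subset] by simp

lemma edge_ball_eq: "a \<in># E \<Longrightarrow> edge_ball ({1..n}, E) l a = gball E l a"
  using verts_subset ends_subset_verts[of a E] by (intro edge_ball_eq_gball) auto

lemma nbhd:
  assumes "a \<in># E"
  shows "nbhd_type k l ({1..n}, E) \<kappa> a = type_of k ((gball E l a, {#e \<in># E. e \<in> edges_near E l a#}),
           restrict \<kappa> (gball E l a), a)" (is "_ = type_of k ?R")
    and "((gball E l a, {#e \<in># E. e \<in> edges_near E l a#}), restrict \<kappa> (gball E l a), a) \<in> rooted_nbhds k l D"
proof -
  let ?N = "gball E l a" let ?F = "{#e \<in># E. e \<in> edges_near E l a#}"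
  have "{#e \<in># E. fst e \<in> ?N \<and> snd e \<in> ?N#} = ?F" by (simp add: edges_near_def ends_def)
  then show "nbhd_type k l ({1..n}, E) \<kappa> a = type_of k ?R"
    unfolding nbhd_type_def Let_def edge_ball_eq[OF assms] induced_subgraph_def prod.case by (simp only:)
  have aF: "a \<in># ?F" using assms ends_subset_gball by (auto simp: edges_near_def)
  have gb: "gball ?F l a = ?N" unfolding edges_near_def using gball_restrict by simp
  have vF: "verts ?F \<subseteq> ?N" by (auto simp: verts_def edges_near_def)
  have "?N \<subseteq> verts ?F" using gball_subset[of ?F l a] ends_subset_verts[OF aF] gb by auto
  have "?N \<subseteq> {1..n}" using gball_subset[of E l a] ends_subset_verts[OF assms] verts_subset by auto
  moreover have \<kappa>: "\<kappa> \<in> {1..n} \<rightarrow>\<^sub>E {1..k}" using coloring by (auto simp: proper_coloring_def)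
  ultimately have "restrict \<kappa> ?N \<in> ?N \<rightarrow>\<^sub>E {1..k}" by (auto simp: PiE_iff)
  moreover have ne: "u \<noteq> v \<and> \<kappa> u \<noteq> \<kappa> v \<and> u \<in> ?N \<and> v \<in> ?N" if "(u, v) \<in># ?F" for u v
    using that graph coloring by (auto simp: is_graph_def proper_coloring_def edges_near_def ends_def)
  have "\<forall>(u, v)\<in>#?F. u \<noteq> v" "\<forall>(u, v)\<in>#?F. restrict \<kappa> ?N u \<noteq> restrict \<kappa> ?N v"
    using ne by (auto simp del: set_mset_filter)
  ultimately have "?R \<in> doubly_rooted k"
    unfolding doubly_rooted_iff using aF vF by simp
  then show "?R \<in> rooted_nbhds k l D"
    using \<open>?N \<subseteq> verts ?F\<close> vF deg_le_mono[OF deg_le multiset_filter_subset] by (auto simp: rooted_nbhds_iff gb)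
qed

lemma nbhd_type_in_types: "a \<in># E \<Longrightarrow> nbhd_type k l ({1..n}, E) \<kappa> a \<in> types k l D"
  using nbhd[of a] by (auto simp: types_eq)

text \<open>The bridge from the stream to the kernel on types: the right-hand side is
  \<open>kern\<close> of \<open>random_order_ge_independent\<close> for the classes
  \<open>edges_near E l a\<close>. Explorations stay inside the neighborhood, so the coloring may be
  left unrestricted.\<close>

lemma type_kernel_nbhd_type:
  assumes "a \<in># E"
  shows "type_kernel k l D (nbhd_type k l ({1..n}, E) \<kappa> a) =
    map_pmf (obs_type k l \<kappa> a)
      (pmf_of_set (permutations_of_multiset ({#e \<in># E. e \<in> edges_near E l a#} - {#a#})))"
proof -
  let ?N = "gball E l a" let ?F = "{#e \<in># E. e \<in> edges_near E l a#}"
  have aF: "a \<in># ?F" using assms ends_subset_gball by (auto simp: edges_near_def)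
  have "obs_type k l (restrict \<kappa> ?N) a w = obs_type k l \<kappa> a w"
    if "w \<in> permutations_of_multiset (?F - {#a#})" for w
  proof -
    have "verts (mset (explore l a w)) \<subseteq> verts ?F"
      by (intro verts_mono set_mset_mono mset_explore_subset[OF that aF])
    also have "\<dots> \<subseteq> ?N" by (auto simp: verts_def edges_near_def)
    finally have "restrict (restrict \<kappa> ?N) (verts (mset (explore l a w))) =
        restrict \<kappa> (verts (mset (explore l a w)))"
      by (auto simp: restrict_def fun_eq_iff)
    then show ?thesis by (simp add: obs_type_def obs_rooted_def)
  qed
  then show ?thesis
    unfolding nbhd(1)[OF assms] type_kernel_type_of[OF nbhd(2)[OF assms]]
    by (auto intro!: map_pmf_cong)
qed

lemma explore_filter_near:
  assumes "a \<in># E" and "set w \<subseteq> set_mset E"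
  shows "explore l a w = explore l a (filter (\<lambda>e. e \<in> edges_near E l a) w)"
  using fold_grow_filter[of "[a]" E w l] assms by (simp add: edges_near_def)

text \<open>The collected part is a ball of its own and inherits the degree bound, so each root
  costs constant memory whatever the order.\<close>

lemma length_explore_le:
  assumes "mset (a # w) \<subseteq># E"
  shows "length (explore l a w) \<le> D * ball_bound l D"
proof -
  have sub: "mset (explore l a w) \<subseteq># E"
    using subset_mset.order_trans[OF mset_explore assms[unfolded mset.simps]] .
  have "size (mset (explore l a w)) \<le> D * card (gball (mset (explore l a w)) l a)"
    by (rule size_edges_le[OF deg_le_mono[OF deg_le sub] verts_explore finite_gball])
  also have "\<dots> \<le> D * ball_bound l D"
    by (intro mult_le_mono2 card_gball_le deg_le_mono[OF deg_le sub])
  finally show ?thesis by simp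
qed

lemma prob_conflict_le:
  assumes "E \<noteq> {#}"
  shows "measure_pmf.prob (pmf_of_multiset E) {b. edges_near E l a \<inter> edges_near E l b \<noteq> {}} \<le>
     ball_bound l D * (D * (D + 1) ^ l) / size E"
proof -
  let ?C = "{b. gball E l a \<inter> gball E l b \<noteq> {}}"
  have "{b. edges_near E l a \<inter> edges_near E l b \<noteq> {}} \<subseteq> ?C"
    by (auto simp: edges_near_def ends_def)
  then have "measure_pmf.prob (pmf_of_multiset E) {b. edges_near E l a \<inter> edges_near E l b \<noteq> {}} \<le>
      measure_pmf.prob (pmf_of_multiset E) ?C"
    by (intro measure_pmf.finite_measure_mono) auto
  also have "\<dots> = size {#b \<in># E. b \<in> ?C#} / size E"
    using assms by (rule measure_pmf_of_multiset)
  also have "\<dots> \<le> ball_bound l D * (D * (D + 1) ^ l) / size E"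
  proof -
    have "size {#b \<in># E. b \<in> ?C#} \<le> ball_bound l D * (D * (D + 1) ^ l)"
      using size_conflict_le[OF deg_le, of l a] by simp
    then show ?thesis by (intro divide_right_mono) (simp_all flip: of_nat_mult of_nat_power of_nat_add)
  qed
  finally show ?thesis .
qed

end

section \<open>The streaming algorithm\<close>

lemma card_bounded_lists_le:
  assumes "finite A"
  shows "card {xs. set xs \<subseteq> A \<and> length xs \<le> N} \<le> (card A + 1) ^ N"
proof -
  have "(\<Sum>i\<le>N. a ^ i) \<le> (a + 1) ^ N" for a :: nat
  proof (induction N)
    case (Suc N)
    have "(\<Sum>i\<le>Suc N. a ^ i) = 1 + a * (\<Sum>i\<le>N. a ^ i)"
      by (simp add: sum.atMost_Suc_shift sum_distrib_left del: sum.atMost_Suc)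
    also have "\<dots> \<le> 1 + a * (a + 1) ^ N" using Suc by simp
    also have "\<dots> \<le> (a + 1) ^ Suc N" by simp
    finally show ?case .
  qed simp
  then show ?thesis using card_lists_length_le[OF assms, of N] by simp
qed

text \<open>The queries are only made after the stream has ended, so that until then the memory holds
  nothing but the state of the update function.\<close>

lemma deterministic_streaming_alg:
  fixes upd :: "edge \<Rightarrow> 's \<Rightarrow> 's" and vl :: "'s \<Rightarrow> nat list" and out :: "'s \<Rightarrow> nat list \<Rightarrow> 'o"
  assumes fin: "finite S" and card: "card S * ((k + 1) ^ Q + 1) \<le> 2 ^ s"
    and out: "\<And>\<sigma> cs. out \<sigma> cs \<in> Out"
    and vl: "\<And>\<sigma>. \<sigma> \<in> S \<Longrightarrow> set (vl \<sigma>) \<subseteq> {1..n} \<and> length (vl \<sigma>) \<le> Q"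
  shows "\<exists>A. is_streaming_alg n s Out A \<and>
    (\<forall>\<kappa> es t. (\<forall>j\<le>length es. fold upd (take j es) init \<in> S) \<and> \<kappa> ` {1..n} \<subseteq> {1..k} \<and>
       length es + Q + 2 \<le> t \<longrightarrow>
       run A \<kappa> t (start A) es =
         return_pmf (Some (out (fold upd es init) (map \<kappa> (vl (fold upd es init))))))"
proof -
  define CL where "CL = {cs. set cs \<subseteq> {1..k} \<and> length cs \<le> Q}"
  \<comment> \<open>\<open>None\<close> marks the reading phase, \<open>Some cs\<close> the answers
    received so far. The value \<open>None\<close> accounts for the \<open>+ 1\<close> in the
    cardinality bound.\<close>
  define St where "St = S \<times> insert None (Some ` CL)"
  have finCL: "finite CL" unfolding CL_def by (intro finite_lists_length_le) simp
  have "card CL \<le> (k + 1) ^ Q"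
    using card_bounded_lists_le[of "{1..k}" Q] by (simp add: CL_def)
  then have "card (insert None (Some ` CL)) \<le> (k + 1) ^ Q + 1"
    using finCL by (simp add: card_insert_if card_image)
  then have "card St \<le> card S * ((k + 1) ^ Q + 1)"
    by (simp add: St_def card_cartesian_product del: One_nat_def)
  also have "\<dots> \<le> card {bs :: bool list. length bs = s}"
    using card card_lists_length_eq[of "UNIV :: bool set" s] by simp
  finally have le: "card St \<le> card {bs :: bool list. length bs = s}" .
  have finSt: "finite St" using fin finCL by (simp add: St_def)
  have finB: "finite {bs :: bool list. length bs = s}"
    using finite_lists_length_eq[of "UNIV :: bool set" s] by simp
  obtain f :: "_ \<Rightarrow> bool list" where f: "f ` St \<subseteq> {bs. length bs = s}" "inj_on f St"
    using card_le_inj[OF finSt finB le] by blast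
  \<comment> \<open>Values outside \<open>St\<close> get a dummy string of the right length, because
    the space condition ranges over all memory contents, reachable or not.\<close>
  define enc where "enc x = (if x \<in> St then f x else replicate s False)" for x
  define dec where "dec = inv_into St f"
  have len [simp]: "length (enc x) = s" for x using f by (auto simp: enc_def)
  have dec: "dec (enc x) = x" if "x \<in> St" for x using that f by (simp add: enc_def dec_def)
  \<comment> \<open>The range test before a query is for memory contents that encode no state, where
    \<open>vl\<close> is unconstrained. Its fallback is never taken in the runs considered
    below.\<close>
  define A :: "'o streaming_alg" where "A = \<lparr>start = enc (init, None),
    instr = (\<lambda>m. case dec m of
      (\<sigma>, None) \<Rightarrow> Read (\<lambda>x. case x of None \<Rightarrow> enc (\<sigma>, Some []) | Some e \<Rightarrow> enc (upd e \<sigma>, None))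
    | (\<sigma>, Some cs) \<Rightarrow>
        if length cs < length (vl \<sigma>) then
          (if vl \<sigma> ! length cs \<in> {1..n}
           then Query (vl \<sigma> ! length cs) (\<lambda>c. enc (\<sigma>, Some (cs @ [c])))
           else Read (\<lambda>_. enc (\<sigma>, None)))
        else Output (out \<sigma> cs))\<rparr>"
  have start_A: "start A = enc (init, None)" by (simp add: A_def)
  have alg: "is_streaming_alg n s Out A"
    unfolding is_streaming_alg_def by (auto simp: A_def out split: option.splits prod.splits)
  \<comment> \<open>One step per edge and one for the end-of-stream signal.\<close>
  have reading: "run A \<kappa> (length es + 1 + t) (enc (\<sigma>, None)) es =
      run A \<kappa> t (enc (fold upd es \<sigma>, Some [])) []"
    if "\<forall>j\<le>length es. fold upd (take j es) \<sigma> \<in> S" for \<kappa> es t \<sigma>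
    using that
  proof (induction es arbitrary: \<sigma>)
    case Nil
    then have "(\<sigma>, None) \<in> St" by (auto simp: St_def)
    from dec[OF this] show ?case by (simp add: A_def)
  next
    case (Cons e es)
    have "(\<sigma>, None) \<in> St" using Cons.prems[rule_format, of 0] by (auto simp: St_def)
    from dec[OF this] have "run A \<kappa> (length (e # es) + 1 + t) (enc (\<sigma>, None)) (e # es) =
        run A \<kappa> (length es + 1 + t) (enc (upd e \<sigma>, None)) es"
      by (simp add: A_def)
    moreover have "\<forall>j\<le>length es. fold upd (take j es) (upd e \<sigma>) \<in> S"
    proof (intro allI impI)
      fix j assume "j \<le> length es"
      then show "fold upd (take j es) (upd e \<sigma>) \<in> S"
        using Cons.prems[rule_format, of "Suc j"] by simp
    qed
    ultimately show ?case using Cons.IH[of "upd e \<sigma>"] by simp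
  qed
  \<comment> \<open>Here \<open>j\<close> counts the outstanding queries; the additional step is the
    output.\<close>
  have querying: "run A \<kappa> (Suc j + t) (enc (\<sigma>, Some (map \<kappa> (take (length (vl \<sigma>) - j) (vl \<sigma>))))) [] =
      return_pmf (Some (out \<sigma> (map \<kappa> (vl \<sigma>))))"
    if \<sigma>: "\<sigma> \<in> S" and \<kappa>: "\<kappa> ` {1..n} \<subseteq> {1..k}" and "j \<le> length (vl \<sigma>)" for \<kappa> t \<sigma> j
    using that(3)
  proof (induction j)
    case 0
    have "set (map \<kappa> (vl \<sigma>)) \<subseteq> {1..k}" using vl[OF \<sigma>] \<kappa> by auto
    then have "(\<sigma>, Some (map \<kappa> (vl \<sigma>))) \<in> St"
      using \<sigma> vl[OF \<sigma>] by (auto simp: St_def CL_def)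
    from dec[OF this] show ?case by (simp add: A_def)
  next
    case (Suc j)
    let ?i = "length (vl \<sigma>) - Suc j"
    have i: "?i < length (vl \<sigma>)" "Suc ?i = length (vl \<sigma>) - j" using Suc.prems by auto
    have "set (map \<kappa> (take ?i (vl \<sigma>))) \<subseteq> {1..k}"
      using vl[OF \<sigma>] \<kappa> set_take_subset[of ?i "vl \<sigma>"] by auto
    then have "(\<sigma>, Some (map \<kappa> (take ?i (vl \<sigma>)))) \<in> St"
      using \<sigma> vl[OF \<sigma>] by (auto simp: St_def CL_def)
    note d = dec[OF this]
    have "vl \<sigma> ! ?i \<in> {1..n}" using vl[OF \<sigma>] nth_mem[OF i(1)] by blast
    then have "run A \<kappa> (Suc (Suc j) + t) (enc (\<sigma>, Some (map \<kappa> (take ?i (vl \<sigma>))))) [] =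
        run A \<kappa> (Suc j + t) (enc (\<sigma>, Some (map \<kappa> (take ?i (vl \<sigma>)) @ [\<kappa> (vl \<sigma> ! ?i)]))) []"
      using d i(1) by (simp add: A_def)
    also have "map \<kappa> (take ?i (vl \<sigma>)) @ [\<kappa> (vl \<sigma> ! ?i)] = map \<kappa> (take (Suc ?i) (vl \<sigma>))"
      using i(1) by (simp add: take_Suc_conv_app_nth)
    finally show ?case using Suc i(2) by simp
  qed
  have "run A \<kappa> t (start A) es =
         return_pmf (Some (out (fold upd es init) (map \<kappa> (vl (fold upd es init)))))"
    if S: "\<forall>j\<le>length es. fold upd (take j es) init \<in> S" and \<kappa>: "\<kappa> ` {1..n} \<subseteq> {1..k}"
      and t: "length es + Q + 2 \<le> t" for \<kappa> es t
  proof -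
    let ?\<sigma> = "fold upd es init"
    have \<sigma>: "?\<sigma> \<in> S" using S[rule_format, of "length es"] by simp
    define t' where "t' = t - (length es + 1 + Suc (length (vl ?\<sigma>)))"
    have t_eq: "t = length es + 1 + (Suc (length (vl ?\<sigma>)) + t')"
      using t vl[OF \<sigma>] by (simp add: t'_def)
    then have "run A \<kappa> t (start A) es = run A \<kappa> (Suc (length (vl ?\<sigma>)) + t') (enc (?\<sigma>, Some [])) []"
      using reading[OF S, of \<kappa> "Suc (length (vl ?\<sigma>)) + t'"] by (simp only: start_A)
    then show ?thesis
      using querying[OF \<sigma> \<kappa>, of "length (vl ?\<sigma>)" t'] by (simp del: run.simps)
  qed
  then show ?thesis using alg by blast
qed

text \<open>The state consists of the first \<open>M + 1\<close> edges, which tell whether there are at most \<open>M\<close> edges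
  in total, and of the subgraphs grown from the first \<open>r\<close> edges.\<close>

definition sample_step :: "nat \<Rightarrow> nat \<Rightarrow> nat \<Rightarrow> edge \<Rightarrow> edge list \<times> edge list list \<Rightarrow> edge list \<times> edge list list" where
  "sample_step l r M e = (\<lambda>(b, os). (if length b \<le> M then b @ [e] else b,
      map (grow l e) os @ (if length os < r then [[e]] else [])))"

text \<open>A new edge is offered to the existing explorations before it may become a root, so
  exploration \<open>i\<close> has seen exactly the edges after position \<open>i\<close>.\<close>

lemma fold_sample_step:
  "fold (sample_step l r M) es ([], []) = (take (M + 1) es,
     map (\<lambda>i. explore l (es ! i) (drop (Suc i) es)) [0..<min r (length es)])"
proof (induction es rule: rev_induct)
  case (snoc e es)
  let ?os = "\<lambda>es. map (\<lambda>i. explore l (es ! i) (drop (Suc i) es)) [0..<min r (length es)]"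
  have m: "map (grow l e) (?os es) =
      map (\<lambda>i. explore l ((es @ [e]) ! i) (drop (Suc i) (es @ [e]))) [0..<min r (length es)]"
    by (auto simp: nth_append)
  have "map (grow l e) (?os es) @ (if length (?os es) < r then [[e]] else []) = ?os (es @ [e])"
  proof (cases "length es < r")
    case True
    then have "min r (length es) = length es" "min r (length (es @ [e])) = Suc (length es)" by auto
    then show ?thesis unfolding m using True by simp
  next
    case False
    then have "min r (length es) = r" "min r (length (es @ [e])) = r" by auto
    then show ?thesis unfolding m by simp
  qed
  then show ?case using snoc by (auto simp: sample_step_def)
qed simp

text \<open>The vertices to query, possibly repeated. The list can be recomputed from the state, so
  the stored answers need no labels.\<close>

definition state_vertices :: "edge list \<times> edge list list \<Rightarrow> nat list" where
  "state_vertices = (\<lambda>(b, os). concat (map (\<lambda>e. [fst e, snd e]) (b @ concat os)))"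

lemma set_state_vertices: "set (state_vertices (b, os)) = verts (mset b) \<union> (\<Union>ob\<in>set os. verts (mset ob))"
  by (auto simp: state_vertices_def verts_def ends_def)

lemma length_state_vertices: "length (state_vertices (b, os)) = 2 * (length b + sum_list (map length os))"
proof -
  have "length (concat (map (\<lambda>e. [fst e, snd e]) xs)) = 2 * length xs" for xs :: "edge list"
    by (induction xs) auto
  then show ?thesis by (simp add: state_vertices_def length_concat del: map_append concat_append)
qed

definition sample_states :: "nat \<Rightarrow> nat \<Rightarrow> nat \<Rightarrow> nat \<Rightarrow> (edge list \<times> edge list list) set" where
  "sample_states n K r M = {b. set b \<subseteq> {1..n} \<times> {1..n} \<and> length b \<le> M + 1} \<times>
     {os. set os \<subseteq> {ob. set ob \<subseteq> {1..n} \<times> {1..n} \<and> length ob \<le> K} \<and> length os \<le> r}"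

lemma finite_sample_states: "finite (sample_states n K r M)"
  unfolding sample_states_def by (intro finite_cartesian_product finite_lists_length_le) auto

text \<open>For \<open>n \<ge> 2\<close> the additive terms are absorbed into powers of
  \<open>n\<close>: \<open>n * n + 1 \<le> n ^ 3\<close> per edge slot, and one more factor
  \<open>n\<close> per exploration. The exponent does not depend on \<open>n\<close>, which is the
  source of the logarithmic space.\<close>

lemma card_sample_states_le:
  assumes "n \<ge> 2"
  shows "card (sample_states n K r M) \<le> n ^ (3 * (M + 1) + (3 * K + 1) * r)"
proof -
  have n3: "n * n + 1 \<le> n ^ 3"
  proof -
    have "n * n + 1 \<le> 2 * (n * n)" using assms by simp
    also have "\<dots> \<le> n * (n * n)" using assms by (rule mult_le_mono1)
    finally show ?thesis by (simp add: power3_eq_cube)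
  qed
  have V: "card {xs. set xs \<subseteq> {1..n} \<times> {1..n} \<and> length xs \<le> N} \<le> n ^ (3 * N)" for N
  proof -
    have "card {xs. set xs \<subseteq> {1..n} \<times> {1..n} \<and> length xs \<le> N} \<le> (n * n + 1) ^ N"
      using card_bounded_lists_le[of "{1..n} \<times> {1..n}" N] by (simp add: card_cartesian_product)
    also have "\<dots> \<le> (n ^ 3) ^ N" by (rule power_mono[OF n3]) simp
    finally show ?thesis by (simp add: power_mult)
  qed
  let ?B = "{ob. set ob \<subseteq> {1..n} \<times> {1..n} \<and> length ob \<le> K}"
  have "finite ?B" by (intro finite_lists_length_le) simp
  then have "card {os. set os \<subseteq> ?B \<and> length os \<le> r} \<le> (card ?B + 1) ^ r"
    by (rule card_bounded_lists_le)
  also have "\<dots> \<le> (n ^ (3 * K + 1)) ^ r"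
  proof (rule power_mono)
    have "card ?B + 1 \<le> n ^ (3 * K) + n ^ (3 * K)" using V[of K] assms by (intro add_mono) auto
    also have "\<dots> = 2 * n ^ (3 * K)" by simp
    also have "\<dots> \<le> n * n ^ (3 * K)" using assms by (rule mult_le_mono1)
    finally show "card ?B + 1 \<le> n ^ (3 * K + 1)" by simp
  qed simp
  finally have "card {os. set os \<subseteq> ?B \<and> length os \<le> r} \<le> n ^ ((3 * K + 1) * r)"
    by (simp only: power_mult)
  then have "card (sample_states n K r M) \<le> n ^ (3 * (M + 1)) * n ^ ((3 * K + 1) * r)"
    unfolding sample_states_def card_cartesian_product by (intro mult_le_mono V)
  then show ?thesis by (simp only: power_add)
qed

lemma sample_states_vertices:
  assumes "\<sigma> \<in> sample_states n K r M"
  shows "set (state_vertices \<sigma>) \<subseteq> {1..n} \<and> length (state_vertices \<sigma>) \<le> 2 * (M + 1 + r * K)"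
proof -
  obtain b os where \<sigma>: "\<sigma> = (b, os)" by force
  have b: "set b \<subseteq> {1..n} \<times> {1..n}" "length b \<le> M + 1"
    and os: "\<And>ob. ob \<in> set os \<Longrightarrow> set ob \<subseteq> {1..n} \<times> {1..n} \<and> length ob \<le> K" "length os \<le> r"
    using assms by (auto simp: \<sigma> sample_states_def)
  have v: "verts (mset xs) \<subseteq> {1..n}" if "set xs \<subseteq> {1..n} \<times> {1..n}" for xs
    using that by (force simp: verts_def ends_def)
  have "sum_list (map length os) \<le> sum_list (map (\<lambda>_. K) os)"
    using os(1) by (intro sum_list_mono) auto
  also have "\<dots> \<le> r * K" using os(2) by (simp add: sum_list_triv)
  finally have "length (state_vertices \<sigma>) \<le> 2 * (M + 1 + r * K)"
    using b(2) by (simp add: \<sigma> length_state_vertices)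
  moreover have "set (state_vertices \<sigma>) \<subseteq> {1..n}"
    unfolding \<sigma> set_state_vertices using v b(1) os(1) by blast
  ultimately show ?thesis by simp
qed

section \<open>From frequencies to the edge distribution\<close>

lemma d_TV_finite:
  assumes "finite Ty" and "set_pmf X \<subseteq> Ty" and "set_pmf Y \<subseteq> Ty"
  shows "d_TV X Y = 1 / 2 * (\<Sum>\<tau>\<in>Ty. \<bar>pmf X \<tau> - pmf Y \<tau>\<bar>)"
proof -
  have "(\<Sum>\<^sub>\<infinity>s. \<bar>pmf X s - pmf Y s\<bar>) = (\<Sum>\<^sub>\<infinity>s\<in>Ty. \<bar>pmf X s - pmf Y s\<bar>)"
  proof (rule infsum_cong_neutral)
    fix s assume "s \<in> UNIV - Ty"
    then have "s \<notin> set_pmf X" "s \<notin> set_pmf Y" using assms by auto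
    then show "\<bar>pmf X s - pmf Y s\<bar> = 0" by (simp add: set_pmf_iff)
  qed auto
  then show ?thesis using assms by (simp add: d_TV_def)
qed

lemma pmf_bind_finite:
  assumes "finite Ty" and "set_pmf X \<subseteq> Ty"
  shows "pmf (bind_pmf X K) \<sigma> = (\<Sum>\<tau>\<in>Ty. pmf (K \<tau>) \<sigma> * pmf X \<tau>)"
  unfolding pmf_bind using assms by (intro integral_measure_pmf_real) auto

text \<open>The triangular inversion applied to the difference of two distributions. Closeness of
  the images is what observed frequencies can certify.\<close>

lemma type_kernel_robust:
  obtains c where "c \<ge> 0" and
    "\<And>X Y \<eta>. set_pmf X \<subseteq> types k l D \<Longrightarrow> set_pmf Y \<subseteq> types k l D \<Longrightarrow>
      (\<And>\<sigma>. \<sigma> \<in> types k l D \<Longrightarrow>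
         \<bar>pmf (bind_pmf X (type_kernel k l D)) \<sigma> - pmf (bind_pmf Y (type_kernel k l D)) \<sigma>\<bar> \<le> \<eta>) \<Longrightarrow>
      d_TV X Y \<le> c * \<eta>"
proof -
  let ?Ty = "types k l D" let ?M = "type_kernel k l D"
  obtain c where c: "c \<ge> 0" and inv:
    "\<And>z \<eta>. (\<And>\<sigma>. \<sigma> \<in> ?Ty \<Longrightarrow> \<bar>\<Sum>\<tau>\<in>?Ty. pmf (?M \<tau>) \<sigma> * z \<tau>\<bar> \<le> \<eta>) \<Longrightarrow> (\<Sum>\<tau>\<in>?Ty. \<bar>z \<tau>\<bar>) \<le> c * \<eta>"
  proof (rule triangular_kernel_robustly_invertible[of ?Ty ?M "type_rank k l D"])
    show "finite ?Ty" by (rule finite_types)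
    show "\<And>\<tau>. \<tau> \<in> ?Ty \<Longrightarrow> pmf (?M \<tau>) \<tau> > 0" by (rule type_kernel_diagonal)
    show "\<sigma> = \<tau> \<or> type_rank k l D \<sigma> < type_rank k l D \<tau>"
      if "\<tau> \<in> ?Ty" "\<sigma> \<in> ?Ty" "pmf (?M \<tau>) \<sigma> \<noteq> 0" for \<sigma> \<tau>
      using type_kernel_triangular[OF that(1), of \<sigma>] that(3) by (simp add: set_pmf_iff)
  qed blast
  show ?thesis
  proof (rule that[of "c / 2"])
    show "c / 2 \<ge> 0" using c by simp
    fix X Y \<eta>
    assume X: "set_pmf X \<subseteq> ?Ty" and Y: "set_pmf Y \<subseteq> ?Ty"
      and close: "\<And>\<sigma>. \<sigma> \<in> ?Ty \<Longrightarrow> \<bar>pmf (bind_pmf X ?M) \<sigma> - pmf (bind_pmf Y ?M) \<sigma>\<bar> \<le> \<eta>"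
    have "(\<Sum>\<tau>\<in>?Ty. pmf (?M \<tau>) \<sigma> * (pmf X \<tau> - pmf Y \<tau>)) =
        pmf (bind_pmf X ?M) \<sigma> - pmf (bind_pmf Y ?M) \<sigma>" for \<sigma>
      unfolding pmf_bind_finite[OF finite_types X] pmf_bind_finite[OF finite_types Y]
      by (simp add: sum_subtractf algebra_simps)
    then have "(\<Sum>\<tau>\<in>?Ty. \<bar>pmf X \<tau> - pmf Y \<tau>\<bar>) \<le> c * \<eta>"
      using close by (intro inv) simp
    then show "d_TV X Y \<le> c / 2 * \<eta>" by (simp add: d_TV_finite[OF finite_types X Y])
  qed
qed

context colored_graph
begin

lemma mem_edges_near: "a \<in> edges_near E l a"
  using ends_subset_gball by (simp add: edges_near_def)

lemma set_edge_dist: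
  assumes "E \<noteq> {#}"
  shows "set_pmf (edge_dist k l ({1..n}, E) \<kappa>) \<subseteq> types k l D"
  using assms nbhd_type_in_types by (auto simp: edge_dist_def)

text \<open>Exploration \<open>i\<close> also sees the later roots, whereas the probabilistic
  analysis uses only the edges after the first \<open>r\<close>. In a good order no later root is
  near root \<open>i\<close>, so both give the same observation.\<close>

lemma observations_of_good_order:
  assumes \<pi>: "\<pi> \<in> permutations_of_multiset E" and r: "r \<le> length \<pi>"
    and good: "sorted_wrt (\<lambda>a b. edges_near E l a \<inter> edges_near E l b = {}) (take r \<pi>)"
  shows "map (\<lambda>i. type_of k (obs_rooted \<kappa> (explore l (\<pi> ! i) (drop (Suc i) \<pi>)))) [0..<r] =
    map (\<lambda>a. obs_type k l \<kappa> a (filter (\<lambda>x. x \<in> edges_near E l a) (drop r \<pi>))) (take r \<pi>)"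
proof (rule nth_equalityI)
  show "length (map (\<lambda>i. type_of k (obs_rooted \<kappa> (explore l (\<pi> ! i) (drop (Suc i) \<pi>)))) [0..<r]) =
    length (map (\<lambda>a. obs_type k l \<kappa> a (filter (\<lambda>x. x \<in> edges_near E l a) (drop r \<pi>))) (take r \<pi>))"
    using r by simp
  fix i
  assume "i < length (map (\<lambda>i. type_of k (obs_rooted \<kappa> (explore l (\<pi> ! i) (drop (Suc i) \<pi>)))) [0..<r])"
  then have i: "i < r" by simp
  have set\<pi>: "set \<pi> = set_mset E" using permutations_of_multisetD[OF \<pi>] by (metis set_mset_mset)
  let ?a = "\<pi> ! i"
  have a: "?a \<in># E" using i r set\<pi> nth_mem[of i \<pi>] by auto
  have split: "drop (Suc i) \<pi> = drop (Suc i) (take r \<pi>) @ drop r \<pi>"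
  proof -
    have "drop (Suc i) \<pi> = drop (Suc i) (take r \<pi> @ drop r \<pi>)" by simp
    also have "\<dots> = drop (Suc i) (take r \<pi>) @ drop (Suc i - length (take r \<pi>)) (drop r \<pi>)"
      by (rule drop_append)
    finally show ?thesis using i r by simp
  qed
  have "filter (\<lambda>x. x \<in> edges_near E l ?a) (drop (Suc i) (take r \<pi>)) = []"
  proof (rule filter_False, rule ballI)
    fix x assume "x \<in> set (drop (Suc i) (take r \<pi>))"
    then obtain j where j: "j < r - Suc i" "x = take r \<pi> ! (Suc i + j)"
      using r by (auto simp: in_set_conv_nth)
    then have "edges_near E l (take r \<pi> ! i) \<inter> edges_near E l x = {}"
      using good r by (simp add: sorted_wrt_iff_nth_less)
    then show "x \<notin> edges_near E l ?a"
      using mem_edges_near[of x] i by (auto simp: nth_take)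
  qed
  then have "filter (\<lambda>x. x \<in> edges_near E l ?a) (drop (Suc i) \<pi>) =
      filter (\<lambda>x. x \<in> edges_near E l ?a) (drop r \<pi>)"
    by (subst split) (simp only: filter_append append_Nil)
  moreover have "set (drop (Suc i) \<pi>) \<subseteq> set_mset E"
    unfolding set\<pi>[symmetric] by (rule set_drop_subset)
  ultimately have "explore l ?a (drop (Suc i) \<pi>) =
      explore l ?a (filter (\<lambda>x. x \<in> edges_near E l ?a) (drop r \<pi>))"
    using explore_filter_near[OF a] by metis
  then show "map (\<lambda>i. type_of k (obs_rooted \<kappa> (explore l (\<pi> ! i) (drop (Suc i) \<pi>)))) [0..<r] ! i =
    map (\<lambda>a. obs_type k l \<kappa> a (filter (\<lambda>x. x \<in> edges_near E l a) (drop r \<pi>))) (take r \<pi>) ! i"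
    using i r by (simp add: obs_type_def)
qed

lemma prob_frequencies_ge:
  assumes E: "E \<noteq> {#}" and r: "r > 0" and \<eta>: "\<eta> \<ge> 0"
  shows "measure_pmf.prob (pmf_of_set (permutations_of_multiset E))
     {\<pi>. r \<le> length \<pi> \<and> (\<forall>\<sigma>\<in>types k l D.
        \<bar>count_list (map (\<lambda>i. type_of k (obs_rooted \<kappa> (explore l (\<pi> ! i) (drop (Suc i) \<pi>)))) [0..<r]) \<sigma> / r -
         pmf (bind_pmf (edge_dist k l ({1..n}, E) \<kappa>) (type_kernel k l D)) \<sigma>\<bar> \<le> \<eta>)} \<ge>
     1 - card (types k l D) * (2 * exp (- 2 * real r * \<eta>\<^sup>2)) -
       real r * real r * (ball_bound l D * (D * (D + 1) ^ l) / size E)"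
proof -
  let ?pr = "measure_pmf.prob (pmf_of_set (permutations_of_multiset E))"
  let ?q = "bind_pmf (edge_dist k l ({1..n}, E) \<kappa>) (type_kernel k l D)"
  define S where "S = {os. \<forall>\<sigma>\<in>types k l D. \<bar>count_list os \<sigma> / r - pmf ?q \<sigma>\<bar> \<le> \<eta>}"
  let ?good = "\<lambda>as. sorted_wrt (\<lambda>a b. edges_near E l a \<inter> edges_near E l b = {}) as"
  let ?kern = "\<lambda>a. map_pmf (obs_type k l \<kappa> a)
     (pmf_of_set (permutations_of_multiset ({#x \<in># E. x \<in> edges_near E l a#} - {#a#})))"
  let ?B = "real (ball_bound l D * (D * (D + 1) ^ l)) / size E"
  \<comment> \<open>Drawing an edge and exploring around it amounts to drawing its type from
    \<open>edge_dist\<close> and applying the kernel.\<close>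
  have q: "bind_pmf (pmf_of_multiset E) ?kern = ?q"
    unfolding edge_dist_def bind_map_pmf snd_conv
    by (intro bind_pmf_cong refl type_kernel_nbhd_type[symmetric]) (use E in simp)
  have "measure_pmf.prob (replicate_pmf r ?q) S =
      1 - measure_pmf.prob (replicate_pmf r ?q) (- S)"
    using measure_pmf.prob_compl[of S "replicate_pmf r ?q"] by (simp add: Compl_eq_Diff_UNIV)
  also have "- S = {os. \<not> (\<forall>\<sigma>\<in>types k l D. \<bar>count_list os \<sigma> / r - pmf ?q \<sigma>\<bar> \<le> \<eta>)}"
    by (auto simp: S_def)
  finally have ideal: "measure_pmf.prob (replicate_pmf r ?q) S \<ge>
      1 - card (types k l D) * (2 * exp (- 2 * real r * \<eta>\<^sup>2))"
    using prob_frequencies_deviation_le[OF finite_types r \<eta>, of ?q] by simp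
  have conflict: "measure_pmf.prob (replicate_pmf r (pmf_of_multiset E)) {as. \<not> ?good as} \<le> real r * real r * ?B"
    using prob_conflict_le[OF E] by (intro prob_replicate_pmf_conflict_le) simp_all
  have "measure_pmf.prob (replicate_pmf r ?q) S -
      measure_pmf.prob (replicate_pmf r (pmf_of_multiset E)) {as. \<not> ?good as} \<le>
      ?pr {\<pi>. length \<pi> \<ge> r \<and> ?good (take r \<pi>) \<and>
         map (\<lambda>a. obs_type k l \<kappa> a (filter (\<lambda>x. x \<in> edges_near E l a) (drop r \<pi>))) (take r \<pi>) \<in> S}"
    using random_order_ge_independent[OF E mem_edges_near, of r "obs_type k l \<kappa>" S] by (simp only: q)
  also have "\<dots> \<le> ?pr {\<pi>. r \<le> length \<pi> \<and>
      map (\<lambda>i. type_of k (obs_rooted \<kappa> (explore l (\<pi> ! i) (drop (Suc i) \<pi>)))) [0..<r] \<in> S}"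
  proof (rule measure_pmf.finite_measure_mono_AE, rule AE_pmfI, rule impI)
    fix \<pi> assume "\<pi> \<in> set_pmf (pmf_of_set (permutations_of_multiset E))"
    then have \<pi>: "\<pi> \<in> permutations_of_multiset E" by simp
    assume "\<pi> \<in> {\<pi>. length \<pi> \<ge> r \<and> ?good (take r \<pi>) \<and>
         map (\<lambda>a. obs_type k l \<kappa> a (filter (\<lambda>x. x \<in> edges_near E l a) (drop r \<pi>))) (take r \<pi>) \<in> S}"
    then show "\<pi> \<in> {\<pi>. r \<le> length \<pi> \<and>
      map (\<lambda>i. type_of k (obs_rooted \<kappa> (explore l (\<pi> ! i) (drop (Suc i) \<pi>)))) [0..<r] \<in> S}"
      using observations_of_good_order[OF \<pi>] by auto
  qed simp
  finally show ?thesis using ideal conflict by (simp add: S_def)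
qed

text \<open>Every prefix of the stream is a sub-multiset of \<open>E\<close>, so the size bounds
  hold throughout the pass. The machine simulates correctly only if all intermediate states can be
  encoded.\<close>

lemma sample_states_reached:
  assumes "\<pi> \<in> permutations_of_multiset E" and "j \<le> length \<pi>"
  shows "fold (sample_step l r M) (take j \<pi>) ([], []) \<in> sample_states n (D * ball_bound l D) r M"
proof -
  have set\<pi>: "set \<pi> = set_mset E" and m\<pi>: "mset \<pi> = E"
    using permutations_of_multisetD[OF assms(1)] by (metis set_mset_mset) (use assms in \<open>auto dest: permutations_of_multisetD\<close>)
  have EV: "set_mset E \<subseteq> {1..n} \<times> {1..n}"
  proof
    fix p assume "p \<in># E"
    then show "p \<in> {1..n} \<times> {1..n}"
      using edge_in_verts[of "fst p" "snd p" E] verts_subset by (cases p) auto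
  qed
  have "set (explore l (take j \<pi> ! i) (drop (Suc i) (take j \<pi>))) \<subseteq> {1..n} \<times> {1..n} \<and>
      length (explore l (take j \<pi> ! i) (drop (Suc i) (take j \<pi>))) \<le> D * ball_bound l D"
    if "i < length (take j \<pi>)" for i
  proof -
    let ?a = "take j \<pi> ! i" and ?w = "drop (Suc i) (take j \<pi>)"
    have "take j \<pi> = take i (take j \<pi>) @ ?a # ?w" using that by (rule id_take_nth_drop)
    then have "mset (?a # ?w) \<subseteq># mset (take j \<pi>)"
      by (metis mset_append mset_subset_eq_add_right)
    also have "mset (take j \<pi>) \<subseteq># E"
      unfolding m\<pi>[symmetric] by (metis append_take_drop_id mset_append mset_subset_eq_add_left)
    finally have sub: "mset (?a # ?w) \<subseteq># E" .
    have "mset (explore l ?a ?w) \<subseteq># E"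
      using subset_mset.order_trans[OF mset_explore sub[unfolded mset.simps]] .
    then have "set (explore l ?a ?w) \<subseteq> set_mset E" using set_mset_mono by fastforce
    then show ?thesis using EV length_explore_le[OF sub] by blast
  qed
  moreover have "set (take (M + 1) (take j \<pi>)) \<subseteq> {1..n} \<times> {1..n}"
    using EV set\<pi> by (auto dest!: in_set_takeD)
  moreover have "set (map (\<lambda>i. explore l (take j \<pi> ! i) (drop (Suc i) (take j \<pi>)))
        [0..<min r (length (take j \<pi>))]) =
      (\<lambda>i. explore l (take j \<pi> ! i) (drop (Suc i) (take j \<pi>))) ` {0..<min r (length (take j \<pi>))}"
    by (simp only: set_map set_upt)
  ultimately show ?thesis
    unfolding fold_sample_step sample_states_def mem_Times_iff fst_conv snd_conv mem_Collect_eq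
    by (intro conjI) (simp_all add: image_subset_iff)
qed

end

text \<open>Not every list of types admits a fit. If the frequencies are accurate, the true edge
  distribution is one, and then the choice does return a fit.\<close>

definition frequency_estimate ::
    "nat \<Rightarrow> nat \<Rightarrow> nat \<Rightarrow> nat \<Rightarrow> real \<Rightarrow> rooted_type list \<Rightarrow> rooted_type pmf" where
  "frequency_estimate k l D r \<eta> ts = (SOME X. set_pmf X \<subseteq> types k l D \<and>
     (\<forall>\<sigma>\<in>types k l D. \<bar>count_list ts \<sigma> / r - pmf (bind_pmf X (type_kernel k l D)) \<sigma>\<bar> \<le> \<eta>))"

definition estimate :: "nat \<Rightarrow> nat \<Rightarrow> nat \<Rightarrow> nat \<Rightarrow> nat \<Rightarrow> nat \<Rightarrow> real \<Rightarrow>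
    edge list \<times> edge list list \<Rightarrow> (nat \<Rightarrow> nat) \<Rightarrow> rooted_type pmf" where
  "estimate k l D n r M \<eta> = (\<lambda>(b, os) \<kappa>.
     if length b \<le> M then edge_dist k l ({1..n}, mset b) \<kappa>
     else frequency_estimate k l D r \<eta> (map (\<lambda>ob. type_of k (obs_rooted \<kappa> ob)) os))"

text \<open>The memory need not come from a \<open>D\<close>-bounded graph, hence the fallback to an arbitrary
  distribution on types.\<close>

definition sample_output :: "nat \<Rightarrow> nat \<Rightarrow> nat \<Rightarrow> nat \<Rightarrow> nat \<Rightarrow> nat \<Rightarrow> real \<Rightarrow>
    edge list \<times> edge list list \<Rightarrow> nat list \<Rightarrow> rooted_type pmf" where
  "sample_output k l D n r M \<eta> \<sigma> cs =
     (let X = estimate k l D n r M \<eta> \<sigma> (the \<circ> map_of (zip (state_vertices \<sigma>) cs))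
      in if set_pmf X \<subseteq> types k l D then X else return_pmf (SOME \<tau>. \<tau> \<in> types k l D))"

lemma sample_output_types:
  assumes "types k l D \<noteq> {}"
  shows "set_pmf (sample_output k l D n r M \<eta> \<sigma> cs) \<subseteq> types k l D"
  using some_in_eq[of "types k l D"] assms by (simp add: sample_output_def Let_def)

context colored_graph
begin

text \<open>The algorithm learns colors only at endpoints of stored edges; the ball of an edge
  contains no other vertices.\<close>

lemma edge_dist_cong:
  assumes "E \<noteq> {#}" and "\<And>v. v \<in> verts E \<Longrightarrow> \<kappa>' v = \<kappa> v"
  shows "edge_dist k l ({1..n}, E) \<kappa>' = edge_dist k l ({1..n}, E) \<kappa>"
proof -
  have "nbhd_type k l ({1..n}, E) \<kappa>' a = nbhd_type k l ({1..n}, E) \<kappa> a" if "a \<in># E" for a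
  proof -
    have "gball E l a \<subseteq> verts E" using gball_subset[of E l a] ends_subset_verts[OF that] by auto
    then have "restrict \<kappa>' (gball E l a) = restrict \<kappa> (gball E l a)"
      using assms(2) by (intro restrict_ext) blast
    then show ?thesis unfolding nbhd_type_def Let_def edge_ball_eq[OF that] by (simp only:)
  qed
  then show ?thesis unfolding edge_dist_def using assms(1) by (auto intro!: map_pmf_cong)
qed

text \<open>The coloring rebuilt from the answers agrees with \<open>\<kappa>\<close> on all stored
  vertices, and the estimate looks nowhere else. The assumption on \<open>X\<close> ensures that the
  fallback in \<open>sample_output\<close> is not taken.\<close>

lemma sample_output_eq:
  fixes r M :: nat and \<eta> :: real
  assumes E: "E \<noteq> {#}" and \<pi>: "\<pi> \<in> permutations_of_multiset E"
  defines "\<sigma> \<equiv> fold (sample_step l r M) \<pi> ([], [])"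
  defines "X \<equiv> (if size E \<le> M then edge_dist k l ({1..n}, E) \<kappa> else frequency_estimate k l D r \<eta>
       (map (\<lambda>i. type_of k (obs_rooted \<kappa> (explore l (\<pi> ! i) (drop (Suc i) \<pi>)))) [0..<min r (size E)]))"
  assumes X: "set_pmf X \<subseteq> types k l D"
  shows "sample_output k l D n r M \<eta> \<sigma> (map \<kappa> (state_vertices \<sigma>)) = X"
proof -
  let ?\<kappa> = "the \<circ> map_of (zip (state_vertices \<sigma>) (map \<kappa> (state_vertices \<sigma>)))"
  let ?os = "map (\<lambda>i. explore l (\<pi> ! i) (drop (Suc i) \<pi>)) [0..<min r (size E)]"
  have m\<pi>: "mset \<pi> = E" and len: "length \<pi> = size E"
    using permutations_of_multisetD[OF \<pi>] by auto
  have \<sigma>: "\<sigma> = (take (M + 1) \<pi>, ?os)" by (simp add: \<sigma>_def fold_sample_step len)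
  have agree: "?\<kappa> v = \<kappa> v" if "v \<in> set (state_vertices \<sigma>)" for v
    using that by (simp add: map_of_zip_map)
  have "estimate k l D n r M \<eta> \<sigma> ?\<kappa> = X"
  proof (cases "size E \<le> M")
    case True
    then have t: "take (M + 1) \<pi> = \<pi>" using len by simp
    have "edge_dist k l ({1..n}, E) ?\<kappa> = edge_dist k l ({1..n}, E) \<kappa>"
    proof (rule edge_dist_cong[OF E])
      fix v assume "v \<in> verts E"
      then have "v \<in> set (state_vertices \<sigma>)" unfolding \<sigma> set_state_vertices t m\<pi> by blast
      then show "?\<kappa> v = \<kappa> v" by (rule agree)
    qed
    then show ?thesis using True len unfolding estimate_def \<sigma> X_def prod.case t m\<pi> by (simp only: if_True)
  next
    case False
    have "type_of k (obs_rooted ?\<kappa> ob) = type_of k (obs_rooted \<kappa> ob)" if "ob \<in> set ?os" for ob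
    proof -
      have "verts (mset ob) \<subseteq> set (state_vertices \<sigma>)" unfolding \<sigma> set_state_vertices using that by blast
      then have "restrict ?\<kappa> (verts (mset ob)) = restrict \<kappa> (verts (mset ob))"
        using agree by (intro restrict_ext) blast
      then show ?thesis unfolding obs_rooted_def by (simp only:)
    qed
    then have m: "map (\<lambda>ob. type_of k (obs_rooted ?\<kappa> ob)) ?os = map (\<lambda>ob. type_of k (obs_rooted \<kappa> ob)) ?os"
      by (rule map_cong[OF refl])
    have "estimate k l D n r M \<eta> \<sigma> ?\<kappa> =
        frequency_estimate k l D r \<eta> (map (\<lambda>ob. type_of k (obs_rooted ?\<kappa> ob)) ?os)"
      using False len by (subst \<sigma>) (simp add: estimate_def)
    also have "\<dots> = X" unfolding m using False by (simp add: X_def o_def)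
    finally show ?thesis .
  qed
  then show ?thesis using X by (simp add: sample_output_def Let_def)
qed

end

lemma exists_sample_size:
  fixes N \<eta> \<delta> :: real
  assumes "\<eta> > 0" and "\<delta> > 0"
  shows "\<exists>r > (0::nat). N * (2 * exp (- 2 * real r * \<eta>\<^sup>2)) \<le> \<delta>"
proof -
  have "LIM r sequentially. 2 * \<eta>\<^sup>2 * real r :> at_top"
    using assms(1)
    by (intro filterlim_tendsto_pos_mult_at_top[OF tendsto_const] filterlim_real_sequentially) auto
  then have "LIM r sequentially. - 2 * real r * \<eta>\<^sup>2 :> at_bot"
    by (simp add: filterlim_uminus_at_bot mult.commute mult.left_commute)
  then have "(\<lambda>r. exp (- 2 * real r * \<eta>\<^sup>2)) \<longlonglongrightarrow> 0"
    by (rule filterlim_compose[OF exp_at_bot])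
  then have "(\<lambda>r. N * (2 * exp (- 2 * real r * \<eta>\<^sup>2))) \<longlonglongrightarrow> N * (2 * 0)"
    by (intro tendsto_intros)
  then have "\<forall>\<^sub>F r in sequentially. N * (2 * exp (- 2 * real r * \<eta>\<^sup>2)) < \<delta>"
    by (rule order_tendstoD) (use assms in simp)
  then obtain r0 where r0: "\<And>r. r \<ge> r0 \<Longrightarrow> N * (2 * exp (- 2 * real r * \<eta>\<^sup>2)) < \<delta>"
    by (auto simp: eventually_sequentially)
  show ?thesis using r0[of "Suc r0"] by (intro exI[of _ "Suc r0"]) (simp del: of_nat_Suc)
qed

theorem theorem4p12:
  fixes k l D :: nat and \<epsilon> \<delta> :: real
  assumes "\<epsilon> > 0" and "\<delta> > 0"
  shows "\<exists>C > (0::real). \<exists>(A :: nat \<Rightarrow> rooted_type pmf streaming_alg) (T :: nat \<Rightarrow> nat).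
    (\<forall>n. \<exists>s. real s \<le> C * log 2 (real n) \<and>
       is_streaming_alg n s {X. set_pmf X \<subseteq> types k l D} (A n)) \<and>
    (\<forall>n E \<kappa>. is_graph ({1..n}, E) \<and> E \<noteq> {#} \<and> degree_bounded D ({1..n}, E) \<and>
       proper_coloring k ({1..n}, E) \<kappa> \<longrightarrow>
       measure_pmf.prob (random_order_run (A n) \<kappa> (T n) E)
         {r. \<not> (\<exists>X. r = Some X \<and> d_TV X (edge_dist k l ({1..n}, E) \<kappa>) \<le> \<epsilon>)} \<le> \<delta>)"
proof -
  let ?Ty = "types k l D" let ?M = "type_kernel k l D"
  obtain c where c: "c \<ge> 0" and robust:
    "\<And>X Y \<eta>. set_pmf X \<subseteq> ?Ty \<Longrightarrow> set_pmf Y \<subseteq> ?Ty \<Longrightarrow>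
      (\<And>\<sigma>. \<sigma> \<in> ?Ty \<Longrightarrow> \<bar>pmf (bind_pmf X ?M) \<sigma> - pmf (bind_pmf Y ?M) \<sigma>\<bar> \<le> \<eta>) \<Longrightarrow> d_TV X Y \<le> c * \<eta>"
    using type_kernel_robust[of k l D] by metis
  \<comment> \<open>The fit and the true distribution are each within \<open>\<eta>\<close> of the
    frequencies, so \<open>c * (2 * \<eta>)\<close> must be at most \<open>\<epsilon>\<close>. Using
    \<open>c + 1\<close> avoids division by zero.\<close>
  define \<eta> where "\<eta> = \<epsilon> / (2 * (c + 1))"
  have \<eta>: "\<eta> > 0" using assms c by (simp add: \<eta>_def)
  have c\<eta>: "c * (2 * \<eta>) \<le> \<epsilon>" using assms c by (simp add: \<eta>_def field_simps)
  obtain r :: nat where r: "r > 0" "card ?Ty * (2 * exp (- 2 * real r * \<eta>\<^sup>2)) \<le> \<delta> / 2"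
    using exists_sample_size[OF \<eta>, of "\<delta> / 2" "card ?Ty"] assms by auto
  define B where "B = real (ball_bound l D * (D * (D + 1) ^ l))"
  \<comment> \<open>Beyond \<open>M\<close> edges the conflict probability is at most
    \<open>\<delta> / 2\<close>, and there are at least \<open>r\<close> roots.\<close>
  define M where "M = max r (nat \<lceil>2 * (real r * real r * B) / \<delta>\<rceil>)"
  have rM: "r \<le> M" by (simp add: M_def)
  have BM: "real r * real r * (B / m) \<le> \<delta> / 2" if "m > M" for m :: nat
  proof -
    have "2 * (real r * real r * B) / \<delta> \<le> real M" unfolding M_def by linarith
    then have "2 * (real r * real r * B) \<le> \<delta> * M" using assms by (simp add: field_simps)
    also have "\<dots> \<le> \<delta> * m" using assms that by simp
    finally show ?thesis using that by (simp add: field_simps)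
  qed
  define K where "K = D * ball_bound l D"
  define Q where "Q = 2 * (M + 1 + r * K)"
  define c0 where "c0 = (k + 1) ^ Q + 1"
  \<comment> \<open>The first two summands come from the number of sample states; the last one pays
    for the stored answers, as \<open>c0 \<le> 2 ^ c0 \<le> n ^ c0\<close>.\<close>
  define e where "e = 3 * (M + 1) + (3 * K + 1) * r + c0"
  let ?st = "\<lambda>es. fold (sample_step l r M) es ([], [])"
  define spec where "spec = (\<lambda>n s A. is_streaming_alg n s {X. set_pmf X \<subseteq> ?Ty} A \<and>
    (\<forall>\<kappa> es t. (\<forall>j\<le>length es. ?st (take j es) \<in> sample_states n K r M) \<and> \<kappa> ` {1..n} \<subseteq> {1..k} \<and>
       length es + Q + 2 \<le> t \<longrightarrow>
       run A \<kappa> t (start A) es =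
         return_pmf (Some (sample_output k l D n r M \<eta> (?st es) (map \<kappa> (state_vertices (?st es)))))))"
  have big: "\<exists>A s. real s \<le> (e + 1) * log 2 n \<and> spec n s A" if n: "n \<ge> 2" and Ty: "?Ty \<noteq> {}" for n
  proof -
    \<comment> \<open>Enough bits to number \<open>n ^ e\<close> states. Rounding up costs at most
      one bit, absorbed by an extra \<open>log 2 n \<ge> 1\<close>; hence the constant
      \<open>e + 1\<close>.\<close>
    define s where "s = nat \<lceil>e * log 2 n\<rceil>"
    have log1: "log 2 n \<ge> 1" using n by (simp add: le_log_iff)
    have "real s \<le> e * log 2 n + 1" unfolding s_def using log1 by (simp add: of_nat_nat)
    then have s_le: "real s \<le> (e + 1) * log 2 n" using log1 by (simp add: algebra_simps)
    have "real (n ^ e) = (2 powr log 2 n) powr e" using n by (simp add: powr_realpow)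
    also have "\<dots> = 2 powr (e * log 2 n)" unfolding powr_powr by (simp only: mult.commute)
    also have "\<dots> \<le> 2 powr s" unfolding s_def by (intro powr_mono) linarith+
    also have "\<dots> = real (2 ^ s)" by (simp add: powr_realpow)
    finally have "n ^ e \<le> 2 ^ s" by (simp only: of_nat_le_iff)
    moreover have "card (sample_states n K r M) * c0 \<le> n ^ e"
    proof -
      have "c0 \<le> 2 ^ c0" by (simp add: less_imp_le)
      also have "\<dots> \<le> n ^ c0" using n by (intro power_mono) auto
      finally show ?thesis unfolding e_def power_add[of n _ c0]
        using card_sample_states_le[OF n] by (intro mult_le_mono)
    qed
    ultimately have "card (sample_states n K r M) * ((k + 1) ^ Q + 1) \<le> 2 ^ s" by (simp add: c0_def)
    then have "\<exists>A. spec n s A" unfolding spec_def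
      using sample_states_vertices[of _ n K r M] sample_output_types[OF Ty]
      by (intro deterministic_streaming_alg finite_sample_states) (auto simp: Q_def)
    then show ?thesis using s_le by blast
  qed
  \<comment> \<open>For \<open>n < 2\<close>, or without types, no admissible graph has an edge, so
    nothing is demanded of the output. A machine with zero bits is used because the space bound
    vanishes for \<open>n = 1\<close>.\<close>
  define A where "A n = (if n \<ge> 2 \<and> ?Ty \<noteq> {}
     then SOME A. \<exists>s. real s \<le> (e + 1) * log 2 n \<and> spec n s A
     else \<lparr>start = [], instr = (\<lambda>_. Read (\<lambda>_. []))\<rparr>)" for n :: nat
  \<comment> \<open>The degree bound allows at most \<open>D * n\<close> edges; \<open>Q + 2\<close>
    steps remain for the end signal, the queries and the output.\<close>
  define T where "T n = D * n + Q + 2" for n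
  have A: "\<exists>s. real s \<le> (e + 1) * log 2 n \<and> spec n s (A n)" if "n \<ge> 2" "?Ty \<noteq> {}" for n
  proof -
    have "A n = (SOME A. \<exists>s. real s \<le> (e + 1) * log 2 n \<and> spec n s A)"
      unfolding A_def using that by (intro if_P) simp
    then show ?thesis using someI_ex[OF big[OF that]] by (simp only:)
  qed
  have space: "\<exists>s. real s \<le> (e + 1) * log 2 n \<and> is_streaming_alg n s {X. set_pmf X \<subseteq> ?Ty} (A n)" for n
  proof (cases "n \<ge> 2 \<and> ?Ty \<noteq> {}")
    case True
    then show ?thesis using A[of n] by (auto simp: spec_def)
  next
    case False
    have "log 2 (real n) \<ge> 0" by (cases "n = 0") (auto simp: log_def)
    then have "real 0 \<le> (e + 1) * log 2 n" by simp
    moreover have "is_streaming_alg n 0 {X. set_pmf X \<subseteq> ?Ty} (A n)"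
      unfolding A_def if_not_P[OF False] by (simp add: is_streaming_alg_def)
    ultimately show ?thesis by blast
  qed
  have "measure_pmf.prob (random_order_run (A n) \<kappa> (T n) E)
         {r. \<not> (\<exists>X. r = Some X \<and> d_TV X (edge_dist k l ({1..n}, E) \<kappa>) \<le> \<epsilon>)} \<le> \<delta>"
    if G: "is_graph ({1..n}, E)" "E \<noteq> {#}" "degree_bounded D ({1..n}, E)" "proper_coloring k ({1..n}, E) \<kappa>"
    for n E \<kappa>
  proof -
    interpret colored_graph k l D n E \<kappa> using G by unfold_locales
    let ?Y = "edge_dist k l ({1..n}, E) \<kappa>"
    let ?out = "\<lambda>\<pi>. sample_output k l D n r M \<eta> (?st \<pi>) (map \<kappa> (state_vertices (?st \<pi>)))"
    let ?perm = "pmf_of_set (permutations_of_multiset E)"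
    have Y: "set_pmf ?Y \<subseteq> ?Ty" using G(2) by (rule set_edge_dist)
    obtain a where a: "a \<in># E" using G(2) by blast
    have Ty: "?Ty \<noteq> {}" using nbhd_type_in_types[OF a] by blast
    have n2: "n \<ge> 2"
    proof -
      have "fst a \<in> {1..n}" "snd a \<in> {1..n}" "fst a \<noteq> snd a"
        using G(1) a by (auto simp: is_graph_def)
      then show ?thesis by auto
    qed
    obtain s where spec: "spec n s (A n)" using A[OF n2 Ty] by blast
    have len: "size E \<le> D * n" using size_edges_le[OF deg_le verts_subset] by simp
    have \<kappa>: "\<kappa> ` {1..n} \<subseteq> {1..k}" using G(4) by (auto simp: proper_coloring_def)
    have run: "run (A n) \<kappa> (T n) (start (A n)) \<pi> = return_pmf (Some (?out \<pi>))"
      if \<pi>: "\<pi> \<in> permutations_of_multiset E" for \<pi>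
    proof -
      have "length \<pi> = size E" using permutations_of_multisetD[OF \<pi>] by auto
      then have "length \<pi> + Q + 2 \<le> T n" using len by (simp add: T_def)
      then show ?thesis
        using spec sample_states_reached[OF \<pi>] \<kappa> unfolding spec_def K_def by blast
    qed
    have "random_order_run (A n) \<kappa> (T n) E = map_pmf (\<lambda>\<pi>. Some (?out \<pi>)) ?perm"
      unfolding random_order_run_def map_pmf_def by (intro bind_pmf_cong refl) (simp add: run)
    then have prob_eq: "measure_pmf.prob (random_order_run (A n) \<kappa> (T n) E)
         {r. \<not> (\<exists>X. r = Some X \<and> d_TV X ?Y \<le> \<epsilon>)} =
        measure_pmf.prob ?perm {\<pi>. \<not> d_TV (?out \<pi>) ?Y \<le> \<epsilon>}"
      by (simp add: vimage_def)
    have "measure_pmf.prob ?perm {\<pi>. d_TV (?out \<pi>) ?Y \<le> \<epsilon>} \<ge> 1 - \<delta>"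
    proof (cases "size E \<le> M")
      case True
      have "d_TV ?Y ?Y = 0" by (simp add: d_TV_def)
      then have "d_TV (?out \<pi>) ?Y \<le> \<epsilon>" if "\<pi> \<in> permutations_of_multiset E" for \<pi>
        using sample_output_eq[OF G(2) that, where M = M and r = r and \<eta> = \<eta>] True Y assms by simp
      then have "measure_pmf.prob ?perm {\<pi>. d_TV (?out \<pi>) ?Y \<le> \<epsilon>} = 1"
        by (subst measure_pmf.prob_eq_1) (auto simp: AE_measure_pmf_iff)
      then show ?thesis using assms by simp
    next
      case False
      let ?obs = "\<lambda>\<pi>. map (\<lambda>i. type_of k (obs_rooted \<kappa> (explore l (\<pi> ! i) (drop (Suc i) \<pi>)))) [0..<r]"
      let ?S = "{\<pi>. r \<le> length \<pi> \<and> (\<forall>\<sigma>\<in>?Ty. \<bar>count_list (?obs \<pi>) \<sigma> / r - pmf (bind_pmf ?Y ?M) \<sigma>\<bar> \<le> \<eta>)}"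
      have "1 - \<delta> \<le> 1 - card ?Ty * (2 * exp (- 2 * real r * \<eta>\<^sup>2)) - real r * real r * (B / size E)"
        using r(2) BM[of "size E"] False by simp
      also have "\<dots> \<le> measure_pmf.prob ?perm ?S"
        using prob_frequencies_ge[OF G(2) r(1), of \<eta>] \<eta> by (simp add: B_def)
      also have "\<dots> \<le> measure_pmf.prob ?perm {\<pi>. d_TV (?out \<pi>) ?Y \<le> \<epsilon>}"
      proof (rule measure_pmf.finite_measure_mono_AE, rule AE_pmfI, rule impI)
        fix \<pi> assume "\<pi> \<in> set_pmf ?perm"
        then have \<pi>: "\<pi> \<in> permutations_of_multiset E" by simp
        assume S: "\<pi> \<in> ?S"
        let ?P = "\<lambda>X. set_pmf X \<subseteq> ?Ty \<and>
          (\<forall>\<sigma>\<in>?Ty. \<bar>count_list (?obs \<pi>) \<sigma> / r - pmf (bind_pmf X ?M) \<sigma>\<bar> \<le> \<eta>)"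
        let ?X = "frequency_estimate k l D r \<eta> (?obs \<pi>)"
        \<comment> \<open>The true distribution witnesses that the choice in
          \<open>frequency_estimate\<close> succeeds.\<close>
        have "?P ?Y" using S Y by blast
        then have X: "?P ?X" unfolding frequency_estimate_def by (rule someI[where P = ?P])
        have "min r (size E) = r" using False rM by simp
        then have "?out \<pi> = ?X"
          using sample_output_eq[OF G(2) \<pi>, where M = M and r = r and \<eta> = \<eta>] False X by simp
        \<comment> \<open>Triangle inequality through the observed frequencies, then the robust
          inversion.\<close>
        moreover have "d_TV ?X ?Y \<le> c * (2 * \<eta>)"
        proof (rule robust)
          fix \<sigma> assume "\<sigma> \<in> ?Ty"
          then have "\<bar>count_list (?obs \<pi>) \<sigma> / r - pmf (bind_pmf ?X ?M) \<sigma>\<bar> \<le> \<eta>"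
            "\<bar>count_list (?obs \<pi>) \<sigma> / r - pmf (bind_pmf ?Y ?M) \<sigma>\<bar> \<le> \<eta>"
            using X \<open>?P ?Y\<close> by blast+
          then show "\<bar>pmf (bind_pmf ?X ?M) \<sigma> - pmf (bind_pmf ?Y ?M) \<sigma>\<bar> \<le> 2 * \<eta>" by linarith
        qed (use X Y in auto)
        ultimately show "\<pi> \<in> {\<pi>. d_TV (?out \<pi>) ?Y \<le> \<epsilon>}" using c\<eta> by simp
      qed simp
      finally show ?thesis .
    qed
    moreover have "measure_pmf.prob ?perm {\<pi>. \<not> d_TV (?out \<pi>) ?Y \<le> \<epsilon>} =
        1 - measure_pmf.prob ?perm {\<pi>. d_TV (?out \<pi>) ?Y \<le> \<epsilon>}"
      using measure_pmf.prob_compl[of "{\<pi>. d_TV (?out \<pi>) ?Y \<le> \<epsilon>}" ?perm]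
      by (simp add: Collect_neg_eq Compl_eq_Diff_UNIV del: not_le)
    ultimately show ?thesis using prob_eq by simp
  qed
  moreover have "real (e + 1) > 0" by simp
  ultimately show ?thesis using space by (intro exI[of _ "real (e + 1)"] conjI exI[of _ A] exI[of _ T]) auto
qed

end
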